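(* Let $(M,\omega,F_t=(J,H_t))$, $0\le t\le1$, be a semitoric family. Let $t_0\in[0,1]$ and let $p$ be a fixed point of $F_{t_0}$ which does not belong to a fixed surface of $J$. Then $p$ is a fixed point of $F_t$ for all $t\in[0,1]$.
   Context: A four-dimensional integrable system $(M,\omega,F=(J,H))$ ($J,H$ Poisson-commuting with $X_J,X_H$ independent almost everywhere) is semitoric if $J$ is proper, $J$ is the momentum map of an effective Hamiltonian $\mathbb{S}^1$-action, and all singular points of $F$ (points where $X_J,X_H$ are dependent) are non-degenerate (in the sense of Williamson/Eliasson) with no hyperbolic components. A semitoric family with degenerate times $t_1,\dots,t_k$ is a family of integrable systems $(M,\omega,F_t=(J,H_t))$, $0\le t\le1$, with $(t,m)\mapsto H_t(m)$ smooth on $[0,1]\times M$, such that $F_t$ is semitoric if and only if $t\notin\{t_1,\dots,t_k\}$. A fixed point of $F_t$ is a point $p$ with $dJ(p)=0$ and $dH_t(p)=0$ (rank zero singular point). A fixed surface of $J$ is a two-dimensional connected component of the fixed-point set of the $\mathbb{S}^1$-action generated by $J$, i.e. of $\{dJ=0\}$. *)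

theory Defs
  imports "HOL-Analysis.Analysis"
begin

section \<open>Smooth maps between Euclidean spaces\<close>

text \<open>Only meaningful on open sets, where it is the usual notion of class $C^k$.\<close>

primrec Ck_on :: "nat \<Rightarrow> ('a::euclidean_space \<Rightarrow> 'b::real_normed_vector) \<Rightarrow> 'a set \<Rightarrow> bool" where
  "Ck_on 0 f W \<longleftrightarrow> continuous_on W f"
| "Ck_on (Suc k) f W \<longleftrightarrow>
     (\<forall>x\<in>W. f differentiable (at x)) \<and> (\<forall>v. Ck_on k (\<lambda>x. frechet_derivative f (at x) v) W)"

text \<open>On a set that is not open (such as $[0,1] \times U$), smoothness means local extendability
  to a smooth map on an open set.\<close>

definition smooth_on :: "'a::euclidean_space set \<Rightarrow> ('a \<Rightarrow> 'b::real_normed_vector) \<Rightarrow> bool" where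
  "smooth_on S f \<longleftrightarrow> (\<forall>x\<in>S. \<exists>W g. open W \<and> x \<in> W \<and> (\<forall>k. Ck_on k g W) \<and> (\<forall>y\<in>S \<inter> W. g y = f y))"


section \<open>Smooth manifolds\<close>

text \<open>A manifold is a Hausdorff, second countable type with a smooth atlas. A chart is a pair
  consisting of its domain and its coordinate map.\<close>

type_synonym ('m, 'n) chart = "'m set \<times> ('m \<Rightarrow> real ^ 'n)"

abbreviation dom_of :: "('m, 'n::finite) chart \<Rightarrow> 'm set" where
  "dom_of c \<equiv> fst c"

abbreviation coord :: "('m, 'n::finite) chart \<Rightarrow> 'm \<Rightarrow> real ^ 'n" where
  "coord c \<equiv> snd c"

abbreviation range_of :: "('m, 'n::finite) chart \<Rightarrow> (real ^ 'n) set" where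
  "range_of c \<equiv> coord c ` dom_of c"

definition param :: "('m, 'n::finite) chart \<Rightarrow> real ^ 'n \<Rightarrow> 'm" where
  "param c = inv_into (dom_of c) (coord c)"

definition is_chart :: "('m::topological_space, 'n::finite) chart \<Rightarrow> bool" where
  "is_chart c \<longleftrightarrow> open (dom_of c) \<and> open (range_of c) \<and>
     homeomorphism (dom_of c) (range_of c) (coord c) (param c)"

definition compatible :: "('m, 'n::finite) chart \<Rightarrow> ('m, 'n) chart \<Rightarrow> bool" where
  "compatible c d \<longleftrightarrow>
     smooth_on (coord c ` (dom_of c \<inter> dom_of d)) (coord d \<circ> param c) \<and>
     smooth_on (coord d ` (dom_of c \<inter> dom_of d)) (coord c \<circ> param d)"

definition smooth_atlas :: "('m::{t2_space,second_countable_topology}, 'n::finite) chart set \<Rightarrow> bool" where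
  "smooth_atlas \<A> \<longleftrightarrow> (\<forall>c\<in>\<A>. is_chart c) \<and> (\<Union>c\<in>\<A>. dom_of c) = UNIV \<and>
     (\<forall>c\<in>\<A>. \<forall>d\<in>\<A>. compatible c d)"

definition smooth_fun :: "('m, 'n::finite) chart set \<Rightarrow> ('m \<Rightarrow> real) \<Rightarrow> bool" where
  "smooth_fun \<A> f \<longleftrightarrow> (\<forall>c\<in>\<A>. smooth_on (range_of c) (f \<circ> param c))"

text \<open>Tangent vectors, covectors and tensors at \<^term>\<open>p\<close> are written in the coordinates of a
  chart \<^term>\<open>c\<close> around \<^term>\<open>p\<close>.\<close>

definition differential :: "('m, 'n::finite) chart \<Rightarrow> ('m \<Rightarrow> real) \<Rightarrow> 'm \<Rightarrow> real ^ 'n \<Rightarrow> real" where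
  "differential c f p = frechet_derivative (f \<circ> param c) (at (coord c p))"

text \<open>The second derivative in the chart; it is independent of the chart where the differential
  of \<^term>\<open>f\<close> vanishes, and it is only used there.\<close>

definition hessian ::
  "('m, 'n::finite) chart \<Rightarrow> ('m \<Rightarrow> real) \<Rightarrow> 'm \<Rightarrow> real ^ 'n \<Rightarrow> real ^ 'n \<Rightarrow> real" where
  "hessian c f p u v =
     frechet_derivative (\<lambda>x. frechet_derivative (f \<circ> param c) (at x) u) (at (coord c p)) v"

definition critical_point :: "('m, 'n::finite) chart set \<Rightarrow> ('m \<Rightarrow> real) \<Rightarrow> 'm \<Rightarrow> bool" where
  "critical_point \<A> f p \<longleftrightarrow> (\<forall>c\<in>\<A>. p \<in> dom_of c \<longrightarrow> differential c f p = (\<lambda>v. 0))"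


section \<open>Symplectic manifolds and Hamiltonian vector fields\<close>

text \<open>A 2-form is given by its local expressions: \<^term>\<open>\<omega> c p\<close> is the bilinear form
  at \<^term>\<open>p\<close> in the coordinates of the chart \<^term>\<open>c\<close>.\<close>

type_synonym ('m, 'n) two_form = "('m, 'n) chart \<Rightarrow> 'm \<Rightarrow> real ^ 'n \<Rightarrow> real ^ 'n \<Rightarrow> real"

definition is_two_form :: "('m, 'n::finite) chart set \<Rightarrow> ('m, 'n) two_form \<Rightarrow> bool" where
  "is_two_form \<A> \<omega> \<longleftrightarrow>
     (\<forall>c\<in>\<A>. \<forall>p\<in>dom_of c. bilinear (\<omega> c p) \<and> (\<forall>v. \<omega> c p v v = 0)) \<and>
     (\<forall>c\<in>\<A>. \<forall>u v. smooth_on (range_of c) (\<lambda>x. \<omega> c (param c x) u v)) \<and>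
     (\<forall>c\<in>\<A>. \<forall>d\<in>\<A>. \<forall>p\<in>dom_of c \<inter> dom_of d.
        let D = frechet_derivative (coord d \<circ> param c) (at (coord c p))
        in \<forall>u v. \<omega> c p u v = \<omega> d p (D u) (D v))"

text \<open>$d\omega = 0$, evaluated on constant coordinate vector fields.\<close>

definition closed_form :: "('m, 'n::finite) chart set \<Rightarrow> ('m, 'n) two_form \<Rightarrow> bool" where
  "closed_form \<A> \<omega> \<longleftrightarrow> (\<forall>c\<in>\<A>. \<forall>p\<in>dom_of c. \<forall>u v w.
     frechet_derivative (\<lambda>x. \<omega> c (param c x) v w) (at (coord c p)) u +
     frechet_derivative (\<lambda>x. \<omega> c (param c x) w u) (at (coord c p)) v +
     frechet_derivative (\<lambda>x. \<omega> c (param c x) u v) (at (coord c p)) w = 0)"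

definition symplectic_manifold ::
  "('m::{t2_space,second_countable_topology}, 'n::finite) chart set \<Rightarrow> ('m, 'n) two_form \<Rightarrow> bool" where
  "symplectic_manifold \<A> \<omega> \<longleftrightarrow> smooth_atlas \<A> \<and> is_two_form \<A> \<omega> \<and> closed_form \<A> \<omega> \<and>
     (\<forall>c\<in>\<A>. \<forall>p\<in>dom_of c. \<forall>u. (\<forall>v. \<omega> c p u v = 0) \<longrightarrow> u = 0)"

text \<open>Sign convention: $\omega(X_f, \cdot) = - df$.\<close>

definition ham_field ::
  "('m, 'n::finite) two_form \<Rightarrow> ('m, 'n) chart \<Rightarrow> ('m \<Rightarrow> real) \<Rightarrow> 'm \<Rightarrow> real ^ 'n" where
  "ham_field \<omega> c f p = (THE X. \<forall>v. \<omega> c p X v = - differential c f p v)"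

definition poisson_commute ::
  "('m, 'n::finite) chart set \<Rightarrow> ('m, 'n) two_form \<Rightarrow> ('m \<Rightarrow> real) \<Rightarrow> ('m \<Rightarrow> real) \<Rightarrow> bool" where
  "poisson_commute \<A> \<omega> f g \<longleftrightarrow>
     (\<forall>c\<in>\<A>. \<forall>p\<in>dom_of c. \<omega> c p (ham_field \<omega> c f p) (ham_field \<omega> c g p) = 0)"


section \<open>Integrable systems with two degrees of freedom\<close>

definition lin_dependent :: "'a::real_vector \<Rightarrow> 'a \<Rightarrow> bool" where
  "lin_dependent X Y \<longleftrightarrow> (\<exists>a b. (a, b) \<noteq> (0, 0) \<and> a *\<^sub>R X + b *\<^sub>R Y = 0)"

definition singular_point ::
  "('m, 4) chart set \<Rightarrow> ('m, 4) two_form \<Rightarrow> ('m \<Rightarrow> real) \<Rightarrow> ('m \<Rightarrow> real) \<Rightarrow> 'm \<Rightarrow> bool" where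
  "singular_point \<A> \<omega> J H p \<longleftrightarrow>
     (\<forall>c\<in>\<A>. p \<in> dom_of c \<longrightarrow> lin_dependent (ham_field \<omega> c J p) (ham_field \<omega> c H p))"

definition fixed_point ::
  "('m, 4) chart set \<Rightarrow> ('m \<Rightarrow> real) \<Rightarrow> ('m \<Rightarrow> real) \<Rightarrow> 'm \<Rightarrow> bool" where
  "fixed_point \<A> J H p \<longleftrightarrow> critical_point \<A> J p \<and> critical_point \<A> H p"

text \<open>``Almost everywhere'' refers to the smooth measure class of the manifold.\<close>

definition integrable_system ::
  "('m::{t2_space,second_countable_topology}, 4) chart set \<Rightarrow> ('m, 4) two_form \<Rightarrow>
     ('m \<Rightarrow> real) \<Rightarrow> ('m \<Rightarrow> real) \<Rightarrow> bool" where
  "integrable_system \<A> \<omega> J H \<longleftrightarrow> symplectic_manifold \<A> \<omega> \<and>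
     smooth_fun \<A> J \<and> smooth_fun \<A> H \<and> poisson_commute \<A> \<omega> J H \<and>
     (\<forall>c\<in>\<A>. negligible (coord c ` {p \<in> dom_of c. singular_point \<A> \<omega> J H p}))"


section \<open>Non-degenerate singular points\<close>

subsection \<open>Cartan subalgebras of the symplectic Lie algebra\<close>

definition lie_bracket :: "real ^ 'n ^ 'n \<Rightarrow> real ^ 'n ^ 'n \<Rightarrow> real ^ 'n ^ 'n" where
  "lie_bracket A B = A ** B - B ** A"

definition sp_algebra :: "(real ^ 'n \<Rightarrow> real ^ 'n \<Rightarrow> real) \<Rightarrow> (real ^ 'n ^ 'n) set" where
  "sp_algebra w = {A. \<forall>u v. w (A *v u) v + w u (A *v v) = 0}"

primrec lower_central :: "(real ^ 'n ^ 'n) set \<Rightarrow> nat \<Rightarrow> (real ^ 'n ^ 'n) set" where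
  "lower_central \<hh> 0 = \<hh>"
| "lower_central \<hh> (Suc k) = span {lie_bracket A B | A B. A \<in> \<hh> \<and> B \<in> lower_central \<hh> k}"

definition cartan_subalgebra :: "(real ^ 'n ^ 'n) set \<Rightarrow> (real ^ 'n ^ 'n) set \<Rightarrow> bool" where
  "cartan_subalgebra \<hh> \<gg> \<longleftrightarrow> subspace \<hh> \<and> \<hh> \<subseteq> \<gg> \<and>
     (\<forall>A\<in>\<hh>. \<forall>B\<in>\<hh>. lie_bracket A B \<in> \<hh>) \<and>
     (\<exists>k. lower_central \<hh> k = {0}) \<and>
     {A\<in>\<gg>. \<forall>B\<in>\<hh>. lie_bracket A B \<in> \<hh>} = \<hh>"

text \<open>Quadratic forms on the symplectic vector space $T_pM$ with the Poisson bracket are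
  identified with the symplectic Lie algebra by sending a form to its (linear) Hamiltonian
  vector field.\<close>

definition ham_linear ::
  "(real ^ 'n \<Rightarrow> real ^ 'n \<Rightarrow> real) \<Rightarrow> (real ^ 'n \<Rightarrow> real ^ 'n \<Rightarrow> real) \<Rightarrow> real ^ 'n ^ 'n" where
  "ham_linear w Q = (THE A. \<forall>u v. w (A *v u) v = - Q u v)"

subsection \<open>Williamson normal forms\<close>

text \<open>The coordinates $(x_1, \xi_1, x_2, \xi_2)$ of the normal form are the components
  1, 2, 3, 4 of a vector (the index 4 equals 0 in the type \<^typ>\<open>4\<close>).\<close>

datatype williamson_type =
  Elliptic_Elliptic | Elliptic_Hyperbolic | Hyperbolic_Hyperbolic | Focus_Focus

fun williamson_q :: "williamson_type \<Rightarrow> (real ^ 4 \<Rightarrow> real) \<times> (real ^ 4 \<Rightarrow> real)" where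
  "williamson_q Elliptic_Elliptic =
     (\<lambda>z. ((z$1)\<^sup>2 + (z$2)\<^sup>2) / 2, \<lambda>z. ((z$3)\<^sup>2 + (z$4)\<^sup>2) / 2)"
| "williamson_q Elliptic_Hyperbolic = (\<lambda>z. ((z$1)\<^sup>2 + (z$2)\<^sup>2) / 2, \<lambda>z. z$3 * z$4)"
| "williamson_q Hyperbolic_Hyperbolic = (\<lambda>z. z$1 * z$2, \<lambda>z. z$3 * z$4)"
| "williamson_q Focus_Focus = (\<lambda>z. z$1 * z$4 - z$3 * z$2, \<lambda>z. z$1 * z$2 + z$3 * z$4)"

definition std_symplectic :: "real ^ 4 \<Rightarrow> real ^ 4 \<Rightarrow> real" where
  "std_symplectic y z = y$1 * z$2 - y$2 * z$1 + y$3 * z$4 - y$4 * z$3"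

text \<open>In suitable linear symplectic coordinates, \<^term>\<open>Q1\<close> and \<^term>\<open>Q2\<close> span the same space
  of quadratic forms as the two model forms.\<close>

definition has_williamson_type ::
  "(real ^ 4 \<Rightarrow> real ^ 4 \<Rightarrow> real) \<Rightarrow> (real ^ 4 \<Rightarrow> real ^ 4 \<Rightarrow> real) \<Rightarrow>
     (real ^ 4 \<Rightarrow> real ^ 4 \<Rightarrow> real) \<Rightarrow> williamson_type \<Rightarrow> bool" where
  "has_williamson_type w Q1 Q2 ty \<longleftrightarrow>
     (\<exists>B :: real ^ 4 ^ 4. (\<forall>y z. w (B *v y) (B *v z) = std_symplectic y z) \<and>
        (\<exists>a b c d. a * d - b * c \<noteq> 0 \<and>
           (\<forall>z. Q1 (B *v z) (B *v z) = a * fst (williamson_q ty) z + b * snd (williamson_q ty) z \<and>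
                Q2 (B *v z) (B *v z) = c * fst (williamson_q ty) z + d * snd (williamson_q ty) z)))"

subsection \<open>Singular points of rank zero and one\<close>

definition nondegenerate_nonhyperbolic_rank0 ::
  "('m, 4) two_form \<Rightarrow> ('m, 4) chart \<Rightarrow> ('m \<Rightarrow> real) \<Rightarrow> ('m \<Rightarrow> real) \<Rightarrow> 'm \<Rightarrow> bool" where
  "nondegenerate_nonhyperbolic_rank0 \<omega> c J H p \<longleftrightarrow>
     cartan_subalgebra
       (span {ham_linear (\<omega> c p) (hessian c J p), ham_linear (\<omega> c p) (hessian c H p)})
       (sp_algebra (\<omega> c p)) \<and>
     (\<exists>ty \<in> {Elliptic_Elliptic, Focus_Focus}.
        has_williamson_type (\<omega> c p) (hessian c J p) (hessian c H p) ty)"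

definition symplectic_orthogonal ::
  "(real ^ 'n \<Rightarrow> real ^ 'n \<Rightarrow> real) \<Rightarrow> (real ^ 'n) set \<Rightarrow> (real ^ 'n) set" where
  "symplectic_orthogonal w L = {u. \<forall>v\<in>L. w u v = 0}"

text \<open>With $L = \mathrm{span}(X_J, X_H)$ and $a\,dJ + b\,dH = 0$ at \<^term>\<open>p\<close>, the Hessian of
  $aJ + bH$ descends to the symplectic plane $L^\omega / L$. It has to be non-degenerate there and,
  in a symplectic basis of that plane (represented by \<^term>\<open>e\<close> and \<^term>\<open>f\<close>), to be a multiple
  of the elliptic model form.\<close>

definition nondegenerate_nonhyperbolic_rank1 ::
  "('m, 4) two_form \<Rightarrow> ('m, 4) chart \<Rightarrow> ('m \<Rightarrow> real) \<Rightarrow> ('m \<Rightarrow> real) \<Rightarrow> 'm \<Rightarrow> bool" where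
  "nondegenerate_nonhyperbolic_rank1 \<omega> c J H p \<longleftrightarrow>
     (\<forall>a b. (a, b) \<noteq> (0, 0) \<and> a *\<^sub>R ham_field \<omega> c J p + b *\<^sub>R ham_field \<omega> c H p = 0 \<longrightarrow>
        (let L = span {ham_field \<omega> c J p, ham_field \<omega> c H p};
             L' = symplectic_orthogonal (\<omega> c p) L;
             Q = hessian c (\<lambda>q. a * J q + b * H q) p
         in (\<forall>u\<in>L'. (\<forall>v\<in>L'. Q u v = 0) \<longrightarrow> u \<in> L) \<and>
            (\<exists>e\<in>L'. \<exists>f\<in>L'. \<omega> c p e f = 1 \<and>
               (\<exists>k. \<forall>x \<xi>. Q (x *\<^sub>R e + \<xi> *\<^sub>R f) (x *\<^sub>R e + \<xi> *\<^sub>R f) = k * ((x\<^sup>2 + \<xi>\<^sup>2) / 2)))))"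

definition nondegenerate_nonhyperbolic ::
  "('m, 4) chart set \<Rightarrow> ('m, 4) two_form \<Rightarrow> ('m \<Rightarrow> real) \<Rightarrow> ('m \<Rightarrow> real) \<Rightarrow> 'm \<Rightarrow> bool" where
  "nondegenerate_nonhyperbolic \<A> \<omega> J H p \<longleftrightarrow>
     (\<forall>c\<in>\<A>. p \<in> dom_of c \<longrightarrow>
        (if fixed_point \<A> J H p then nondegenerate_nonhyperbolic_rank0 \<omega> c J H p
         else nondegenerate_nonhyperbolic_rank1 \<omega> c J H p))"


section \<open>Semitoric systems and families\<close>

text \<open>The circle is $\mathbb{R} / 2\pi\mathbb{Z}$.\<close>

definition smooth_circle_action ::
  "('m::topological_space, 'n::finite) chart set \<Rightarrow> (real \<Rightarrow> 'm \<Rightarrow> 'm) \<Rightarrow> bool" where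
  "smooth_circle_action \<A> \<Phi> \<longleftrightarrow>
     \<Phi> 0 = id \<and> (\<forall>s t. \<Phi> (s + t) = \<Phi> s \<circ> \<Phi> t) \<and> \<Phi> (2 * pi) = id \<and>
     continuous_on UNIV (\<lambda>(s, p). \<Phi> s p) \<and>
     (\<forall>c\<in>\<A>. \<forall>d\<in>\<A>. smooth_on {(s, x). x \<in> range_of c \<and> \<Phi> s (param c x) \<in> dom_of d}
        (\<lambda>(s, x). coord d (\<Phi> s (param c x))))"

definition effective_action :: "(real \<Rightarrow> 'm \<Rightarrow> 'm) \<Rightarrow> bool" where
  "effective_action \<Phi> \<longleftrightarrow> (\<forall>s. \<Phi> s = id \<longrightarrow> (\<exists>k::int. s = 2 * pi * of_int k))"

definition momentum_map_of ::
  "('m, 'n::finite) chart set \<Rightarrow> ('m, 'n) two_form \<Rightarrow> (real \<Rightarrow> 'm \<Rightarrow> 'm) \<Rightarrow> ('m \<Rightarrow> real) \<Rightarrow> bool" where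
  "momentum_map_of \<A> \<omega> \<Phi> J \<longleftrightarrow> (\<forall>c\<in>\<A>. \<forall>p\<in>dom_of c.
     ((\<lambda>s. coord c (\<Phi> s p)) has_vector_derivative ham_field \<omega> c J p) (at 0))"

definition semitoric_system ::
  "('m::{t2_space,second_countable_topology}, 4) chart set \<Rightarrow> ('m, 4) two_form \<Rightarrow>
     ('m \<Rightarrow> real) \<Rightarrow> ('m \<Rightarrow> real) \<Rightarrow> bool" where
  "semitoric_system \<A> \<omega> J H \<longleftrightarrow> integrable_system \<A> \<omega> J H \<and>
     (\<forall>K. compact K \<longrightarrow> compact (J -` K)) \<and>
     (\<exists>\<Phi>. smooth_circle_action \<A> \<Phi> \<and> effective_action \<Phi> \<and> momentum_map_of \<A> \<omega> \<Phi> J) \<and>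
     (\<forall>p. singular_point \<A> \<omega> J H p \<longrightarrow> nondegenerate_nonhyperbolic \<A> \<omega> J H p)"

text \<open>\<^term>\<open>T\<close> is the set of degenerate times $t_1, \dots, t_k$.\<close>

definition semitoric_family ::
  "('m::{t2_space,second_countable_topology}, 4) chart set \<Rightarrow> ('m, 4) two_form \<Rightarrow>
     ('m \<Rightarrow> real) \<Rightarrow> (real \<Rightarrow> 'm \<Rightarrow> real) \<Rightarrow> real set \<Rightarrow> bool" where
  "semitoric_family \<A> \<omega> J H T \<longleftrightarrow> finite T \<and> T \<subseteq> {0..1} \<and>
     (\<forall>t\<in>{0..1}. integrable_system \<A> \<omega> J (H t)) \<and>
     (\<forall>c\<in>\<A>. smooth_on ({0..1} \<times> range_of c) (\<lambda>(t, x). H t (param c x))) \<and>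
     (\<forall>t\<in>{0..1}. semitoric_system \<A> \<omega> J (H t) \<longleftrightarrow> t \<notin> T)"

text \<open>A component of the fixed-point set is two-dimensional if it is an embedded surface, i.e.
  each of its points has a slice chart.\<close>

definition fixed_surface ::
  "('m::topological_space, 4) chart set \<Rightarrow> ('m \<Rightarrow> real) \<Rightarrow> 'm set \<Rightarrow> bool" where
  "fixed_surface \<A> J S \<longleftrightarrow> S \<in> components {p. critical_point \<A> J p} \<and>
     (\<forall>q\<in>S. \<exists>d. is_chart d \<and> (\<forall>c\<in>\<A>. compatible c d) \<and> q \<in> dom_of d \<and>
        coord d ` (S \<inter> dom_of d) = {x \<in> range_of d. x$3 = 0 \<and> x$4 = 0})"

end

theory Submission
  imports Defs
begin

text \<open>Write X_f for the Hamiltonian vector field of f. Only finitely many times are degenerate, so the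
system is semitoric at some time, and J generates a circle action whose fixed points are the
critical points of J. Let q be a critical point of J, Q the Hessian of J at q, and N the kernel
of Q.

The subspace N is symplectic. The linearisation L of X_J at q is given by Q and the symplectic
form; if N met its symplectic complement, which is the range of L, then L would have a nilpotent
Jordan block at the eigenvalue 0, and orbits near q would drift away instead of closing up after
time 2 pi (lemma \<open>nilpotent_imp_zero\<close>). So the dimension of N is 0, 2 or 4. It is not 4, because
non-degeneracy of the singular point q at the semitoric time excludes Q = 0
(lemma \<open>hessian_nonzero_at_critical_point\<close>).

If N = 0, then q is an isolated critical point of J. Moreover J Poisson commutes with every H_t, so
dJ(X_H) = 0 for H = H_t; differentiating this at q gives Q(X_H(q), v) = 0 for all v, and thus
dH(q) = 0. Hence q is a fixed point at all times.

If N is a plane, then the critical points of J near q form a surface. The two equations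
dJ(v) = 0, for v in a complement of N, cut out a surface by the inverse function theorem. At a point x
of this surface the other components of dJ vanish as well: over one period the displacement of
an orbit is zero, and to first order its symplectic products with the vectors of N are, up to sign, the
values of dJ at x on these vectors times the period. So these values are small compared with the
length of dJ at x, and must be 0
(lemmas \<open>differential_on_kernel_small\<close> and \<open>critical_if_transverse_part_zero\<close>). This argument
takes the place of an equivariant linearisation of the action.

Suppose now that N is a plane at p. An isolated critical point is a whole connected component of the
critical set, so all points in the component of p are of the second kind. The component is then
a fixed surface through p, which the hypothesis excludes. Hence N = 0 at p, and p stays fixed.\<close>

section \<open>Calculus of $C^k$ maps\<close>

lemma frechet_derivative_cong_open:
  assumes "open W" "x \<in> W" "\<And>y. y \<in> W \<Longrightarrow> f y = g y"
  shows "frechet_derivative f (at x) = frechet_derivative g (at x)"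
proof -
  have "(f has_derivative D) (at x) \<longleftrightarrow> (g has_derivative D) (at x)" for D
    using assms by (metis has_derivative_transform_within_open)
  then show ?thesis by (simp add: frechet_derivative_def)
qed

lemma Ck_on_subset: "Ck_on k f W \<Longrightarrow> V \<subseteq> W \<Longrightarrow> Ck_on k f V"
  by (induction k arbitrary: f) (auto intro: continuous_on_subset)

lemma Ck_on_cong:
  assumes "open W" "Ck_on k f W" "\<And>y. y \<in> W \<Longrightarrow> f y = g y"
  shows "Ck_on k g W"
  using assms(2,3)
proof (induction k arbitrary: f g)
  case 0
  then show ?case by (metis Ck_on.simps(1) continuous_on_cong)
next
  case (Suc k)
  have "Ck_on k (\<lambda>x. frechet_derivative g (at x) v) W" for v
  proof (rule Suc.IH)
    show "Ck_on k (\<lambda>x. frechet_derivative f (at x) v) W" using Suc.prems by simp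
    show "\<And>y. y \<in> W \<Longrightarrow> frechet_derivative f (at y) v = frechet_derivative g (at y) v"
      using frechet_derivative_cong_open[OF assms(1)] Suc.prems(2) by metis
  qed
  moreover have "g differentiable (at x)" if "x \<in> W" for x
    using Suc.prems that assms(1) unfolding differentiable_def
    by (metis Ck_on.simps(2) differentiable_def has_derivative_transform_within_open)
  ultimately show ?case by simp
qed

lemma Ck_on_imp_continuous_on: "Ck_on k f W \<Longrightarrow> continuous_on W f"
  by (cases k) (auto intro!: differentiable_imp_continuous_on differentiable_at_imp_differentiable_on)

lemma Ck_on_lower: "Ck_on (Suc k) f W \<Longrightarrow> Ck_on k f W"
proof (induction k arbitrary: f)
  case 0 then show ?case using Ck_on_imp_continuous_on by (metis Ck_on.simps(1))
next
  case (Suc k) then show ?case by (metis Ck_on.simps(2))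
qed

lemma Ck_on_has_derivative:
  "Ck_on (Suc k) f W \<Longrightarrow> x \<in> W \<Longrightarrow> (f has_derivative frechet_derivative f (at x)) (at x)"
  by (simp add: frechet_derivative_works)

lemma Ck_on_SucI:
  assumes "open W" "\<And>x. x \<in> W \<Longrightarrow> (f has_derivative f' x) (at x)"
    and "\<And>v. Ck_on k (\<lambda>x. f' x v) W"
  shows "Ck_on (Suc k) f W"
proof -
  have "Ck_on k (\<lambda>x. frechet_derivative f (at x) v) W" for v
    by (rule Ck_on_cong[OF assms(1) assms(3)[of v]]) (metis assms(2) frechet_derivative_at)
  then show ?thesis using assms(2) by (auto simp: differentiable_def)
qed

lemma Ck_on_local:
  assumes "\<And>x. x \<in> S \<Longrightarrow> \<exists>W. open W \<and> x \<in> W \<and> Ck_on k f W"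
  shows "Ck_on k f S"
  using assms
proof (induction k arbitrary: f)
  case 0
  show ?case unfolding Ck_on.simps
  proof (rule continuous_at_imp_continuous_on, rule ballI)
    fix x assume "x \<in> S"
    then show "isCont f x" using 0 by (metis Ck_on.simps(1) continuous_on_eq_continuous_at)
  qed
next
  case (Suc k)
  show ?case unfolding Ck_on.simps
  proof (intro conjI ballI allI)
    show "f differentiable at x" if "x \<in> S" for x using Suc.prems[OF that] by auto
    show "Ck_on k (\<lambda>x. frechet_derivative f (at x) v) S" for v
      by (rule Suc.IH) (use Suc.prems in force)
  qed
qed

lemma smooth_on_open_iff:
  assumes "open S"
  shows "smooth_on S f \<longleftrightarrow> (\<forall>k. Ck_on k f S)"
proof
  assume L: "smooth_on S f"
  show "\<forall>k. Ck_on k f S"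
  proof (intro allI Ck_on_local)
    fix k x assume "x \<in> S"
    then obtain W g where W: "open W" "x \<in> W" "\<And>k. Ck_on k g W" "\<And>y. y \<in> S \<inter> W \<Longrightarrow> g y = f y"
      using L unfolding smooth_on_def by metis
    have "Ck_on k f (S \<inter> W)"
      using Ck_on_cong[of "S \<inter> W" k g f] Ck_on_subset[OF W(3)] W assms by (simp add: open_Int)
    then show "\<exists>W. open W \<and> x \<in> W \<and> Ck_on k f W" using W assms \<open>x \<in> S\<close> by blast
  qed
next
  assume "\<forall>k. Ck_on k f S" then show "smooth_on S f" unfolding smooth_on_def using assms by blast
qed

lemma Ck_on_const: "open W \<Longrightarrow> Ck_on k (\<lambda>x. c) W"
  by (induction k arbitrary: c) (auto intro!: Ck_on_SucI[where f'="\<lambda>_ _. 0"] simp del: Ck_on.simps(2))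

lemma Ck_on_linear_compose:
  assumes "open W" "bounded_linear L" "Ck_on k f W"
  shows "Ck_on k (\<lambda>x. L (f x)) W"
  using assms(3)
proof (induction k arbitrary: f)
  case 0 then show ?case
    using assms(2) by (simp add: bounded_linear.continuous_on)
next
  case (Suc k)
  show ?case
  proof (rule Ck_on_SucI[OF assms(1)])
    show "((\<lambda>x. L (f x)) has_derivative (\<lambda>v. L (frechet_derivative f (at x) v))) (at x)" if "x \<in> W" for x
      using bounded_linear.has_derivative[OF assms(2) Ck_on_has_derivative[OF Suc.prems that]] .
    show "Ck_on k (\<lambda>x. L (frechet_derivative f (at x) v)) W" for v
      by (rule Suc.IH) (use Suc.prems in simp)
  qed
qed

lemma Ck_on_linear:
  assumes "open W" "bounded_linear L"
  shows "Ck_on k L W"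
proof (cases k)
  case 0 then show ?thesis using assms(2) by (simp add: bounded_linear.continuous_on[OF _ continuous_on_id])
next
  case (Suc m)
  show ?thesis unfolding Suc
    by (rule Ck_on_SucI[OF assms(1), where f'="\<lambda>_. L"])
      (auto intro: Ck_on_const assms bounded_linear_imp_has_derivative)
qed

lemma Ck_on_add:
  assumes "open W" "Ck_on k f W" "Ck_on k g W"
  shows "Ck_on k (\<lambda>x. f x + g x) W"
  using assms(2,3)
proof (induction k arbitrary: f g)
  case 0 then show ?case by (simp add: continuous_on_add)
next
  case (Suc k)
  show ?case
  proof (rule Ck_on_SucI[OF assms(1)])
    show "((\<lambda>x. f x + g x) has_derivative
        (\<lambda>v. frechet_derivative f (at x) v + frechet_derivative g (at x) v)) (at x)" if "x \<in> W" for x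
      using has_derivative_add Ck_on_has_derivative[OF _ that] Suc.prems by blast
    show "Ck_on k (\<lambda>x. frechet_derivative f (at x) v + frechet_derivative g (at x) v) W" for v
      by (rule Suc.IH) (use Suc.prems in simp_all)
  qed
qed

lemma Ck_on_sum:
  assumes "open W" "\<And>i. i \<in> I \<Longrightarrow> Ck_on k (f i) W"
  shows "Ck_on k (\<lambda>x. \<Sum>i\<in>I. f i x) W"
  using assms(2)
  by (induction I rule: infinite_finite_induct) (auto intro: Ck_on_const Ck_on_add assms(1))

lemma Ck_on_bilinear:
  assumes "open W" "bounded_bilinear B" "Ck_on k f W" "Ck_on k g W"
  shows "Ck_on k (\<lambda>x. B (f x) (g x)) W"
  using assms(3,4)
proof (induction k arbitrary: f g)
  case 0 then show ?case using assms(2) by (simp add: bounded_bilinear.continuous_on)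
next
  case (Suc k)
  show ?case
  proof (rule Ck_on_SucI[OF assms(1)])
    show "((\<lambda>x. B (f x) (g x)) has_derivative
        (\<lambda>v. B (f x) (frechet_derivative g (at x) v) + B (frechet_derivative f (at x) v) (g x))) (at x)"
      if "x \<in> W" for x
      using bounded_bilinear.FDERIV[OF assms(2) Ck_on_has_derivative[OF Suc.prems(1) that]
          Ck_on_has_derivative[OF Suc.prems(2) that]] .
    show "Ck_on k (\<lambda>x. B (f x) (frechet_derivative g (at x) v)
        + B (frechet_derivative f (at x) v) (g x)) W" for v
      using Suc.prems Suc.prems[THEN Ck_on_lower]
      by (intro Ck_on_add[OF assms(1)] Suc.IH) auto
  qed
qed

lemmas Ck_on_mult = Ck_on_bilinear[OF _ bounded_bilinear_mult]
  and Ck_on_scaleR = Ck_on_bilinear[OF _ bounded_bilinear_scaleR]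

lemma Ck_on_prod:
  fixes f :: "'i \<Rightarrow> 'a::euclidean_space \<Rightarrow> real"
  assumes "open W" "\<And>i. i \<in> I \<Longrightarrow> Ck_on k (f i) W"
  shows "Ck_on k (\<lambda>x. \<Prod>i\<in>I. f i x) W"
  using assms(2)
  by (induction I rule: infinite_finite_induct) (auto intro: Ck_on_const Ck_on_mult assms(1))

lemma Ck_on_compose:
  fixes f :: "'a::euclidean_space \<Rightarrow> 'b::euclidean_space" and g :: "'b \<Rightarrow> 'c::real_normed_vector"
  assumes "open W" "open V" "f ` W \<subseteq> V" "Ck_on k f W" "Ck_on k g V"
  shows "Ck_on k (\<lambda>x. g (f x)) W"
  using assms(4,5)
proof (induction k arbitrary: g)
  case 0 then show ?case using assms(3) by (auto intro: continuous_on_compose2)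
next
  case (Suc k)
  let ?f = "\<lambda>x. frechet_derivative f (at x)" and ?g = "\<lambda>x. frechet_derivative g (at x)"
  show ?case
  proof (rule Ck_on_SucI[OF assms(1)])
    fix x assume x: "x \<in> W"
    have fx: "f x \<in> V" using x assms(3) by auto
    have df: "(f has_derivative ?f x) (at x)" using Ck_on_has_derivative[OF Suc.prems(1) x] .
    have dg: "(g has_derivative ?g (f x)) (at (f x))" using Ck_on_has_derivative[OF Suc.prems(2) fx] .
    have lin: "linear (?g (f x))" using dg has_derivative_linear by blast
    have "?g (f x) (?f x v) = (\<Sum>b\<in>Basis. (?f x v \<bullet> b) *\<^sub>R ?g (f x) b)" for v
      by (subst euclidean_representation[of "?f x v", symmetric])
        (simp only: linear_sum[OF lin] linear_scale[OF lin])
    then show "((\<lambda>x. g (f x)) has_derivative (\<lambda>v. \<Sum>b\<in>Basis. (?f x v \<bullet> b) *\<^sub>R ?g (f x) b)) (at x)"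
      using has_derivative_compose[OF df dg] by simp
  next
    fix v
    have "Ck_on k (\<lambda>x. (?f x v \<bullet> b) *\<^sub>R ?g (f x) b) W" for b
    proof (rule Ck_on_scaleR[OF assms(1)])
      show "Ck_on k (\<lambda>x. ?f x v \<bullet> b) W"
        by (rule Ck_on_linear_compose[OF assms(1) bounded_linear_inner_left])
          (use Suc.prems in simp)
      show "Ck_on k (\<lambda>x. ?g (f x) b) W"
        by (rule Suc.IH) (use Suc.prems Ck_on_lower in auto)
    qed
    then show "Ck_on k (\<lambda>x. \<Sum>b\<in>Basis. (?f x v \<bullet> b) *\<^sub>R ?g (f x) b) W"
      by (intro Ck_on_sum assms(1))
  qed
qed

lemma Ck_on_inverse_real: "Ck_on k (inverse :: real \<Rightarrow> real) (- {0})"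
proof (induction k)
  case 0 then show ?case by (auto intro!: continuous_intros)
next
  case (Suc k)
  have o: "open (- {0::real})" by auto
  show ?case
  proof (rule Ck_on_SucI[OF o])
    show "(inverse has_derivative (\<lambda>v. - (inverse x * v * inverse x))) (at x)" if "x \<in> - {0}" for x :: real
      using has_derivative_inverse' that by auto
    show "Ck_on k (\<lambda>x. - (inverse x * v * inverse x)) (- {0})" for v :: real
      by (rule Ck_on_linear_compose[OF o bounded_linear_minus[OF bounded_linear_ident]])
         (intro Ck_on_mult o Suc Ck_on_const)
  qed
qed

lemma Ck_on_inverse:
  fixes f :: "'a::euclidean_space \<Rightarrow> real"
  assumes "open W" "Ck_on k f W" "\<And>x. x \<in> W \<Longrightarrow> f x \<noteq> 0"
  shows "Ck_on k (\<lambda>x. inverse (f x)) W"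
proof (rule Ck_on_compose[OF assms(1) _ _ assms(2) Ck_on_inverse_real])
  show "open (- {0::real})" by (simp add: open_Compl)
  show "f ` W \<subseteq> - {0}" using assms(3) by auto
qed

lemma Ck_on_det:
  assumes "open W" "\<And>i l. Ck_on k (\<lambda>x. A x $ i $ l) W"
  shows "Ck_on k (\<lambda>x. det (A x :: real ^ 'n ^ 'n)) W"
  unfolding det_def
  by (intro Ck_on_sum[OF assms(1)] Ck_on_mult[OF assms(1)] Ck_on_const[OF assms(1)]
      Ck_on_prod[OF assms(1)] assms(2))

lemma Ck_on_vec:
  fixes f :: "'a::euclidean_space \<Rightarrow> real ^ 'n"
  assumes "open W" "\<And>i. Ck_on k (\<lambda>x. f x $ i) W"
  shows "Ck_on k f W"
proof -
  have "f = (\<lambda>x. \<Sum>i\<in>UNIV. (f x $ i) *\<^sub>R axis i 1)"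
    by (simp add: basis_expansion flip: scalar_mult_eq_scaleR)
  moreover have "Ck_on k (\<lambda>x. \<Sum>i\<in>UNIV. (f x $ i) *\<^sub>R axis i (1::real)) W"
    by (intro Ck_on_sum[OF assms(1)] Ck_on_scaleR[OF assms(1)] Ck_on_const assms)
  ultimately show ?thesis by metis
qed

text \<open>By Cramer's rule the solution is a rational expression in the coefficients.\<close>

lemma Ck_on_matrix_equation_solution:
  fixes A :: "'a::euclidean_space \<Rightarrow> real ^ 'n ^ 'n" and z b :: "'a \<Rightarrow> real ^ 'n"
  assumes W: "open W" and A: "\<And>i l. Ck_on k (\<lambda>x. A x $ i $ l) W"
    and b: "\<And>i. Ck_on k (\<lambda>x. b x $ i) W"
    and det: "\<And>x. x \<in> W \<Longrightarrow> det (A x) \<noteq> 0"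
    and z: "\<And>x. x \<in> W \<Longrightarrow> A x *v z x = b x"
  shows "Ck_on k z W"
proof (rule Ck_on_vec[OF W])
  fix i
  let ?M = "\<lambda>x. \<chi> r s. if s = i then b x $ r else A x $ r $ s"
  have M: "Ck_on k (\<lambda>x. ?M x $ r $ s) W" for r s
    using A b by (cases "s = i") simp_all
  have "Ck_on k (\<lambda>x. det (?M x) * inverse (det (A x))) W"
    by (intro Ck_on_mult W Ck_on_inverse Ck_on_det M A det)
  moreover have "det (?M x) * inverse (det (A x)) = z x $ i" if "x \<in> W" for x
    using cramer[OF det[OF that], of "z x" "b x"] z[OF that] by (simp add: divide_inverse)
  ultimately show "Ck_on k (\<lambda>x. z x $ i) W" by (rule Ck_on_cong[OF W])
qed

text \<open>The derivative of the inverse solves a linear system whose matrix is the Jacobian of f along g. So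
each order of differentiability of g yields the next one.\<close>

lemma Ck_on_inverse_function:
  fixes f g :: "real ^ 'n \<Rightarrow> real ^ 'n"
  assumes V: "open V" and U: "open U" and gV: "g ` V \<subseteq> U" and f: "\<And>k. Ck_on k f U"
    and g': "\<And>y. y \<in> V \<Longrightarrow> (g has_derivative g' y) (at y)"
    and fg: "\<And>y. y \<in> V \<Longrightarrow> f (g y) = y"
  shows "Ck_on k g V"
proof (induction k)
  case 0
  show ?case unfolding Ck_on.simps
    by (rule continuous_at_imp_continuous_on) (use g' has_derivative_continuous in blast)
next
  case (Suc k)
  let ?D = "\<lambda>x. frechet_derivative f (at x)"
  have D: "(f has_derivative ?D x) (at x)" if "x \<in> U" for x
    using Ck_on_has_derivative[OF f that] .
  have inv: "?D (g y) (g' y v) = v" if y: "y \<in> V" for y v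
  proof -
    have "((\<lambda>y. f (g y)) has_derivative (\<lambda>v. ?D (g y) (g' y v))) (at y)"
      using has_derivative_compose[OF g'[OF y] D] y gV by auto
    then have "((\<lambda>y. y) has_derivative (\<lambda>v. ?D (g y) (g' y v))) (at y)"
      by (rule has_derivative_transform_within_open[OF _ V y]) (simp add: fg)
    then show ?thesis using has_derivative_unique[OF _ has_derivative_ident] by metis
  qed
  have lin: "linear (?D (g y))" if "y \<in> V" for y
    using D[of "g y"] has_derivative_linear that gV by blast
  show ?case
  proof (rule Ck_on_SucI[OF V g'])
    fix v
    show "Ck_on k (\<lambda>y. g' y v) V"
    proof (rule Ck_on_matrix_equation_solution[OF V, where A="\<lambda>y. matrix (?D (g y))" and b="\<lambda>_. v"])
      fix y assume y: "y \<in> V"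
      show "matrix (?D (g y)) *v g' y v = v" using inv[OF y] matrix_works[OF lin[OF y, folded linear_matrix_vector_mul_eq]] by simp
      have lg: "linear (g' y)" using g'[OF y] has_derivative_linear by blast
      have "matrix (?D (g y)) ** matrix (g' y) = matrix (?D (g y) \<circ> g' y)"
        using matrix_compose[OF lg lin[OF y]] by simp
      also have "?D (g y) \<circ> g' y = id" using inv[OF y] by auto
      finally have "det (matrix (?D (g y))) * det (matrix (g' y)) = 1"
        using det_mul[of "matrix (?D (g y))" "matrix (g' y)"] by (simp only: matrix_id_mat_1 det_I)
      then show "det (matrix (?D (g y))) \<noteq> 0" by auto
    next
      fix i l
      have "Ck_on k (\<lambda>x. ?D x (axis l 1) $ i) U"
        by (rule Ck_on_linear_compose[OF U bounded_linear_vec_nth]) (use f[of "Suc k"] in simp)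
      then show "Ck_on k (\<lambda>y. matrix (?D (g y)) $ i $ l) V"
        unfolding matrix_def using Ck_on_compose[OF V U gV Suc] by simp
    qed (rule Ck_on_const[OF V])
  qed
qed

section \<open>Symmetry of second derivatives\<close>

lemma has_real_derivative_along_line:
  fixes f :: "'a::real_normed_vector \<Rightarrow> real"
  assumes "(f has_derivative f') (at (a + s *\<^sub>R u))"
  shows "((\<lambda>s. f (a + s *\<^sub>R u)) has_real_derivative f' u) (at s)"
proof -
  have "((\<lambda>s. a + s *\<^sub>R u) has_derivative (\<lambda>k. k *\<^sub>R u)) (at s)"
    by (auto intro!: derivative_eq_intros)
  from has_derivative_compose[OF this assms]
  have "((\<lambda>s. f (a + s *\<^sub>R u)) has_derivative (\<lambda>k. f' (k *\<^sub>R u))) (at s)" .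
  moreover have "f' (k *\<^sub>R u) = f' u * k" for k
    using linear_scale[OF has_derivative_linear[OF assms]] by simp
  ultimately show ?thesis by (simp add: has_field_derivative_def)
qed

text \<open>The mean value theorem is applied twice, first in the direction u and then in the direction v. The second
difference of f is symmetric in u and v, and the symmetry of the second derivative follows in the limit.\<close>

lemma second_difference_mean_value:
  fixes f :: "'a::euclidean_space \<Rightarrow> real"
  assumes f: "Ck_on 2 f W" and W: "ball x r \<subseteq> W" and h: "0 < h" "h * (norm u + norm v) < r"
  obtains y where "dist x y \<le> h * (norm u + norm v)"
    and "f (x + h *\<^sub>R u + h *\<^sub>R v) - f (x + h *\<^sub>R u) - f (x + h *\<^sub>R v) + f x
      = h\<^sup>2 * frechet_derivative (\<lambda>z. frechet_derivative f (at z) u) (at y) v"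
proof -
  let ?D = "\<lambda>z. frechet_derivative f (at z) u"
  have near: "dist x (x + s *\<^sub>R u + t *\<^sub>R v) \<le> h * (norm u + norm v)"
    if "0 \<le> s" "s \<le> h" "0 \<le> t" "t \<le> h" for s t
  proof -
    have "norm (s *\<^sub>R u + t *\<^sub>R v) \<le> norm (s *\<^sub>R u) + norm (t *\<^sub>R v)" by (rule norm_triangle_ineq)
    also have "\<dots> \<le> h * norm u + h * norm v"
      using that by (intro add_mono) (auto intro: mult_right_mono)
    finally have "norm (s *\<^sub>R u + t *\<^sub>R v) \<le> h * (norm u + norm v)" by (simp add: distrib_left)
    moreover have "dist (x + s *\<^sub>R u + t *\<^sub>R v) x = norm (s *\<^sub>R u + t *\<^sub>R v)"
      by (simp add: dist_norm)
    ultimately show ?thesis by (simp only: dist_commute)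
  qed
  then have inW: "x + s *\<^sub>R u + t *\<^sub>R v \<in> W"
    if "0 \<le> s" "s \<le> h" "0 \<le> t" "t \<le> h" for s t
    using near[OF that] W h(2) by (auto simp: subset_iff)
  have f2: "Ck_on (Suc 1) f W" using f by (simp add: numeral_2_eq_2)
  have df: "((\<lambda>s. f (x + s *\<^sub>R u + t *\<^sub>R v)) has_real_derivative ?D (x + s *\<^sub>R u + t *\<^sub>R v)) (at s)"
    if "0 \<le> s" "s \<le> h" "0 \<le> t" "t \<le> h" for s t
  proof -
    have eq: "x + s *\<^sub>R u + t *\<^sub>R v = (x + t *\<^sub>R v) + s *\<^sub>R u" for s by (simp add: add_ac)
    show ?thesis
      using has_real_derivative_along_line[of f _ "x + t *\<^sub>R v" s u]
        Ck_on_has_derivative[OF f2 inW[OF that]] unfolding eq by blast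
  qed
  have "\<exists>s>0. s < h \<and> (f (x + h *\<^sub>R u + h *\<^sub>R v) - f (x + h *\<^sub>R u + 0 *\<^sub>R v))
      - (f (x + 0 *\<^sub>R u + h *\<^sub>R v) - f (x + 0 *\<^sub>R u + 0 *\<^sub>R v))
      = (h - 0) * (?D (x + s *\<^sub>R u + h *\<^sub>R v) - ?D (x + s *\<^sub>R u + 0 *\<^sub>R v))"
    by (rule MVT2[OF h(1), where f="\<lambda>s. f (x + s *\<^sub>R u + h *\<^sub>R v) - f (x + s *\<^sub>R u + 0 *\<^sub>R v)"])
      (rule DERIV_diff; rule df; use h in simp)
  then obtain s where s: "0 < s" "s < h" and 1:
    "f (x + h *\<^sub>R u + h *\<^sub>R v) - f (x + h *\<^sub>R u) - f (x + h *\<^sub>R v) + f x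
      = h * (?D (x + s *\<^sub>R u + h *\<^sub>R v) - ?D (x + s *\<^sub>R u + 0 *\<^sub>R v))"
    by (auto simp: algebra_simps)
  let ?E = "\<lambda>y. frechet_derivative ?D (at y)"
  have D1: "Ck_on (Suc 0) ?D W" using f by (simp add: numeral_2_eq_2)
  have dD: "((\<lambda>t. ?D (x + s *\<^sub>R u + t *\<^sub>R v)) has_real_derivative ?E (x + s *\<^sub>R u + t *\<^sub>R v) v) (at t)"
    if "0 \<le> t" "t \<le> h" for t
    by (rule has_real_derivative_along_line[where f="?D" and f'="?E (x + s *\<^sub>R u + t *\<^sub>R v)"],
        rule Ck_on_has_derivative[OF D1 inW]) (use that s in simp_all)
  obtain t where t: "0 < t" "t < h" and 2:
    "?D (x + s *\<^sub>R u + h *\<^sub>R v) - ?D (x + s *\<^sub>R u + 0 *\<^sub>R v) = (h - 0) * ?E (x + s *\<^sub>R u + t *\<^sub>R v) v"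
    using MVT2[OF h(1), of "\<lambda>t. ?D (x + s *\<^sub>R u + t *\<^sub>R v)" "\<lambda>t. ?E (x + s *\<^sub>R u + t *\<^sub>R v) v"] dD by blast
  show ?thesis
    by (rule that[OF near[of s t]]) (use s t 1 2 in \<open>simp_all add: power2_eq_square\<close>)
qed

lemma second_derivative_symmetric:
  fixes f :: "'a::euclidean_space \<Rightarrow> real"
  assumes W: "open W" "x \<in> W" and f: "Ck_on 2 f W"
  shows "frechet_derivative (\<lambda>z. frechet_derivative f (at z) u) (at x) v
    = frechet_derivative (\<lambda>z. frechet_derivative f (at z) v) (at x) u"
proof (rule ccontr)
  let ?E = "\<lambda>u v y. frechet_derivative (\<lambda>z. frechet_derivative f (at z) u) (at y) v"
  assume neq: "?E u v x \<noteq> ?E v u x"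
  define e where "e = \<bar>?E u v x - ?E v u x\<bar> / 2"
  have e: "e > 0" using neq by (simp add: e_def)
  have cont: "isCont (?E u v) x" for u v
    using f W by (auto simp: numeral_2_eq_2 continuous_on_eq_continuous_at)
  then have *: "\<exists>d>0. \<forall>y. dist x y < d \<longrightarrow> \<bar>?E u v y - ?E u v x\<bar> < e" for u v
  proof -
    obtain d where "d > 0" "\<forall>y. dist y x < d \<longrightarrow> dist (?E u v y) (?E u v x) < e"
      using cont[of u v] e unfolding continuous_at_eps_delta by blast
    then show ?thesis by (auto simp: dist_real_def dist_commute intro!: exI[of _ d])
  qed
  obtain d1 d2 where d: "d1 > 0" "\<And>y. dist x y < d1 \<Longrightarrow> \<bar>?E u v y - ?E u v x\<bar> < e"
    "d2 > 0" "\<And>y. dist x y < d2 \<Longrightarrow> \<bar>?E v u y - ?E v u x\<bar> < e"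
    using *[of u v] *[of v u] by blast
  obtain r where r: "r > 0" "ball x r \<subseteq> W" using W open_contains_ball by blast
  define R where "R = min r (min d1 d2)"
  define h where "h = R / (norm u + norm v + 1)"
  have R: "R > 0" "R \<le> r" "R \<le> d1" "R \<le> d2" using r d by (auto simp: R_def)
  have pos: "0 < norm u + norm v + 1" by (simp add: add_nonneg_pos)
  have h: "h > 0" "h * (norm u + norm v) < R"
    using R(1) pos by (auto simp: h_def field_simps)
  have hr: "h * (norm u + norm v) < r" "h * (norm v + norm u) < r"
    using h(2) R(2) by (simp_all add: add.commute)
  obtain y where y: "dist x y \<le> h * (norm u + norm v)"
    "f (x + h *\<^sub>R u + h *\<^sub>R v) - f (x + h *\<^sub>R u) - f (x + h *\<^sub>R v) + f x = h\<^sup>2 * ?E u v y"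
    by (rule second_difference_mean_value[OF f r(2) h(1) hr(1)])
  obtain z where z: "dist x z \<le> h * (norm v + norm u)"
    "f (x + h *\<^sub>R v + h *\<^sub>R u) - f (x + h *\<^sub>R v) - f (x + h *\<^sub>R u) + f x = h\<^sup>2 * ?E v u z"
    by (rule second_difference_mean_value[OF f r(2) h(1) hr(2)])
  have swap: "x + h *\<^sub>R v + h *\<^sub>R u = x + h *\<^sub>R u + h *\<^sub>R v" by (simp add: add_ac)
  have "h\<^sup>2 * ?E u v y = h\<^sup>2 * ?E v u z" using y(2) z(2)[unfolded swap] by linarith
  then have "?E u v y = ?E v u z" using h by simp
  moreover have "\<bar>?E u v y - ?E u v x\<bar> < e" using d(2) y(1) h(2) R by simp
  moreover have "\<bar>?E v u z - ?E v u x\<bar> < e" using d(4) z(1) h(2) R by (simp add: add.commute)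
  ultimately show False unfolding e_def by (smt (verit) field_sum_of_halves)
qed

section \<open>Bilinear forms and drift along curves\<close>

lemma bilinear_expansion:
  fixes B :: "'a::euclidean_space \<Rightarrow> 'b::euclidean_space \<Rightarrow> real"
  assumes "bilinear B"
  shows "B u v = (\<Sum>a\<in>Basis. \<Sum>b\<in>Basis. (u \<bullet> a) * (v \<bullet> b) * B a b)"
proof -
  have l: "linear (\<lambda>u. B u v)" "linear (B u)" for u v using assms by (auto simp: bilinear_def)
  have "B u v = (\<Sum>a\<in>Basis. (u \<bullet> a) * B a v)"
    by (subst euclidean_representation[of u, symmetric])
      (simp only: linear_sum[OF l(1)] linear_scale[OF l(1)] real_scaleR_def)
  also have "\<dots> = (\<Sum>a\<in>Basis. (u \<bullet> a) * (\<Sum>b\<in>Basis. (v \<bullet> b) * B a b))"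
  proof (rule sum.cong[OF refl])
    fix a :: 'a
    have "B a v = (\<Sum>b\<in>Basis. (v \<bullet> b) * B a b)"
      by (subst euclidean_representation[of v, symmetric])
        (simp only: linear_sum[OF l(2)] linear_scale[OF l(2)] real_scaleR_def)
    then show "(u \<bullet> a) * B a v = (u \<bullet> a) * (\<Sum>b\<in>Basis. (v \<bullet> b) * B a b)" by simp
  qed
  finally show ?thesis by (simp add: sum_distrib_left mult.assoc)
qed

text \<open>Pointwise continuity of the coefficients is enough for a bound that is uniform in u and v, since there
are finitely many coefficients.\<close>

lemma bilinear_family_close:
  fixes B :: "'p::metric_space \<Rightarrow> 'a::euclidean_space \<Rightarrow> 'b::euclidean_space \<Rightarrow> real"
  assumes U: "open U" "x0 \<in> U" and bil: "\<forall>x\<in>U. bilinear (B x)"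
    and cont: "\<And>u v. continuous_on U (\<lambda>x. B x u v)" and e: "e > 0"
  shows "\<exists>d>0. ball x0 d \<subseteq> U \<and>
    (\<forall>x\<in>ball x0 d. \<forall>u v. \<bar>B x u v - B x0 u v\<bar> \<le> e * norm u * norm v)"
proof -
  define f where "f x = (\<Sum>a\<in>Basis. \<Sum>b\<in>Basis. \<bar>B x a b - B x0 a b\<bar>)" for x
  have "continuous_on U f" unfolding f_def by (intro continuous_intros cont)
  then have "open (U \<inter> f -` {..<e})" using U(1) by (simp add: continuous_on_open_vimage Int_commute)
  then have "open {x \<in> U. f x < e}" by (simp add: vimage_def Int_def)
  moreover have "x0 \<in> {x \<in> U. f x < e}" using U e by (simp add: f_def)
  ultimately obtain d where d: "d > 0" "ball x0 d \<subseteq> {x \<in> U. f x < e}"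
    using open_contains_ball by meson
  show ?thesis
  proof (intro exI[of _ d] conjI ballI allI)
    show "d > 0" "ball x0 d \<subseteq> U" using d by auto
    fix x u v assume "x \<in> ball x0 d"
    then have x: "x \<in> U" "f x < e" using d by auto
    have "B x u v - B x0 u v = (\<Sum>a\<in>Basis. \<Sum>b\<in>Basis. (u \<bullet> a) * (v \<bullet> b) * (B x a b - B x0 a b))"
      unfolding bilinear_expansion[OF bspec[OF bil x(1)], of u v] bilinear_expansion[OF bspec[OF bil U(2)], of u v]
      by (simp add: sum_subtractf[symmetric] right_diff_distrib)
    also have "\<bar>\<dots>\<bar> \<le> (\<Sum>a\<in>Basis. \<Sum>b\<in>Basis. norm u * norm v * \<bar>B x a b - B x0 a b\<bar>)"
      by (intro order_trans[OF sum_abs] sum_mono)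
        (auto simp: abs_mult intro!: mult_mono Basis_le_norm)
    also have "\<dots> = norm u * norm v * f x" by (simp add: f_def sum_distrib_left)
    also have "\<dots> \<le> norm u * norm v * e" using x by (intro mult_left_mono) auto
    finally show "\<bar>B x u v - B x0 u v\<bar> \<le> e * norm u * norm v" by (simp add: mult_ac)
  qed
qed

text \<open>This takes the place of integration over a period: if the curve h closes up at time s, then the
bound says that the mean velocity c has norm at most K.\<close>

lemma drift_bound:
  fixes h :: "real \<Rightarrow> 'a::real_normed_vector"
  assumes "\<And>s. s \<in> {0..b} \<Longrightarrow> (h has_vector_derivative h' s) (at s)"
    and "\<And>s. s \<in> {0..b} \<Longrightarrow> norm (h' s - c) \<le> K" and s: "s \<in> {0..b}"
  shows "norm (h s - h 0 - s *\<^sub>R c) \<le> K * s"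
proof -
  have "norm ((h s - s *\<^sub>R c) - (h 0 - 0 *\<^sub>R c)) \<le> K * norm (s - 0)"
  proof (rule differentiable_bound[where S="{0..b}" and f'="\<lambda>t k. k *\<^sub>R (h' t - c)"])
    fix t assume t: "t \<in> {0..b}"
    have "((\<lambda>t. h t - t *\<^sub>R c) has_vector_derivative (h' t - c)) (at t)"
      using assms(1)[OF t] by (auto intro!: derivative_eq_intros)
    then show "((\<lambda>t. h t - t *\<^sub>R c) has_derivative (\<lambda>k. k *\<^sub>R (h' t - c))) (at t within {0..b})"
      unfolding has_vector_derivative_def by (rule has_derivative_at_withinI)
    show "onorm (\<lambda>k. k *\<^sub>R (h' t - c)) \<le> K"
      using assms(2)[OF t] by (intro onorm_le) (simp add: mult.commute[of K] mult_left_mono)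
  qed (use s in auto)
  then show ?thesis using s by (simp add: algebra_simps)
qed

text \<open>The vector that represents a linear functional with respect to the inner product.\<close>

definition gradient_of :: "('a::euclidean_space \<Rightarrow> real) \<Rightarrow> 'a" where
  "gradient_of f = (\<Sum>b\<in>Basis. f b *\<^sub>R b)"

lemma inner_gradient_of:
  assumes "linear f" shows "gradient_of f \<bullet> v = f v"
proof -
  have "f v = (\<Sum>b\<in>Basis. (v \<bullet> b) * f b)"
    by (subst euclidean_representation[of v, symmetric])
      (simp only: linear_sum[OF assms] linear_scale[OF assms] real_scaleR_def)
  then show ?thesis
    by (simp add: gradient_of_def inner_sum_left inner_sum_right inner_commute[of _ v] mult.commute)
qed

lemma linear_gradient_of_bilinear:
  assumes "bilinear B" shows "linear (\<lambda>u. gradient_of (B u))"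
  using assms unfolding gradient_of_def bilinear_def
  by (intro linear_compose_sum ballI) (simp add: linear_iff scaleR_left_distrib)

section \<open>Critical points of a function on Euclidean space\<close>

text \<open>A critical point of a function j, with second derivative Q and its kernel N. The order of the
arguments of Q follows the definition of the Hessian.\<close>

locale critical_jet =
  fixes U :: "'a::euclidean_space set" and j :: "'a \<Rightarrow> real" and x0 :: 'a
  assumes open_U: "open U" and x0: "x0 \<in> U" and smooth_j: "\<And>k. Ck_on k j U"
    and crit: "frechet_derivative j (at x0) = (\<lambda>v. 0)"
begin

abbreviation "dj \<equiv> \<lambda>x. frechet_derivative j (at x)"
abbreviation "Q \<equiv> \<lambda>u. frechet_derivative (\<lambda>x. dj x u) (at x0)"
abbreviation "N \<equiv> {u. \<forall>v. Q u v = 0}"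

lemma linear_dj: "x \<in> U \<Longrightarrow> linear (dj x)"
  using Ck_on_has_derivative[OF smooth_j] has_derivative_linear by blast

lemma smooth_dj: "Ck_on k (\<lambda>x. dj x u) U"
  using smooth_j[of "Suc k"] by simp

lemma dj_has_derivative:
  "x \<in> U \<Longrightarrow> ((\<lambda>x. dj x u) has_derivative frechet_derivative (\<lambda>x. dj x u) (at x)) (at x)"
  using Ck_on_has_derivative[OF smooth_dj] .

lemma second_derivative_sym:
  "x \<in> U \<Longrightarrow> frechet_derivative (\<lambda>x. dj x u) (at x) v = frechet_derivative (\<lambda>x. dj x v) (at x) u"
  using second_derivative_symmetric[OF open_U _ smooth_j] .

lemma bilinear_second_derivative:
  assumes "x \<in> U" shows "bilinear (\<lambda>u. frechet_derivative (\<lambda>x. dj x u) (at x))"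
proof -
  have l: "linear (frechet_derivative (\<lambda>x. dj x u) (at x))" for u
    using dj_has_derivative[OF assms] has_derivative_linear by blast
  then show ?thesis unfolding bilinear_def using second_derivative_sym[OF assms] by simp
qed

lemma Q_sym: "Q u v = Q v u" using second_derivative_sym[OF x0] .

lemma bilinear_Q: "bilinear Q" using bilinear_second_derivative[OF x0] .

lemma linear_Q: "linear (Q u)" using bilinear_Q by (simp add: bilinear_def)

lemma subspace_N: "subspace N"
  unfolding subspace_def mem_Collect_eq
  using bilinear_ladd[OF bilinear_Q] bilinear_lzero[OF bilinear_Q] bilinear_lmul[OF bilinear_Q] by simp

lemma span_N: "span N = N" using subspace_N by (rule span_eq_iff[THEN iffD2])

abbreviation "S \<equiv> \<lambda>u. gradient_of (Q u)"

lemma linear_S: "linear S" using linear_gradient_of_bilinear[OF bilinear_Q] .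

lemma inner_S: "S u \<bullet> v = Q u v" using inner_gradient_of[OF linear_Q] .

lemma kernel_S: "S u = 0 \<longleftrightarrow> u \<in> N"
proof
  assume "S u = 0"
  then have "Q u v = 0" for v using inner_S[of u v] by simp
  then show "u \<in> N" by simp
qed (simp add: gradient_of_def)

text \<open>The derivative in z of dj z u - Q u z is small near \<open>x0\<close>, so the mean value inequality applies
on a ball. Both base points x and y vary: later x is the start of an orbit, and y runs along it.\<close>

lemma differential_expansion:
  assumes e: "e > 0"
  shows "\<exists>d>0. ball x0 d \<subseteq> U \<and> (\<forall>x\<in>ball x0 d. \<forall>y\<in>ball x0 d. \<forall>u.
    \<bar>dj y u - dj x u - Q u (y - x)\<bar> \<le> e * norm u * norm (y - x))"
proof -
  have cont: "continuous_on U (\<lambda>x. frechet_derivative (\<lambda>x. dj x u) (at x) v)" for u v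
    using smooth_dj[of "Suc 0" u] by simp
  have bil: "\<forall>x\<in>U. bilinear (\<lambda>u. frechet_derivative (\<lambda>x. dj x u) (at x))"
    using bilinear_second_derivative by blast
  obtain d where d: "d > 0" "ball x0 d \<subseteq> U"
    "\<forall>x\<in>ball x0 d. \<forall>u v. \<bar>frechet_derivative (\<lambda>x. dj x u) (at x) v - Q u v\<bar> \<le> e * norm u * norm v"
    using bilinear_family_close[where B="\<lambda>x u. frechet_derivative (\<lambda>x. dj x u) (at x)",
        OF open_U x0 bil cont e] by (elim exE conjE) (rule that)
  show ?thesis
  proof (intro exI[of _ d] conjI ballI allI d(1,2))
    fix x y u assume xy: "x \<in> ball x0 d" "y \<in> ball x0 d"
    have "norm ((dj y u - Q u y) - (dj x u - Q u x)) \<le> (e * norm u) * norm (y - x)"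
    proof (rule differentiable_bound[OF convex_ball _ _ xy(2,1)])
      fix z assume z: "z \<in> ball x0 d"
      have "z \<in> U" using z d(2) by blast
      show "((\<lambda>z. dj z u - Q u z) has_derivative
          (\<lambda>v. frechet_derivative (\<lambda>x. dj x u) (at z) v - Q u v)) (at z within ball x0 d)"
        by (rule has_derivative_at_withinI, rule has_derivative_diff[OF dj_has_derivative[OF \<open>z \<in> U\<close>]
              linear_imp_has_derivative[OF linear_Q]])
      show "onorm (\<lambda>v. frechet_derivative (\<lambda>x. dj x u) (at z) v - Q u v) \<le> e * norm u"
        using d(3)[rule_format, OF z] by (intro onorm_le) simp
    qed
    moreover have "(dj y u - Q u y) - (dj x u - Q u x) = dj y u - dj x u - Q u (y - x)"
      using linear_diff[OF linear_Q, of u y x] by simp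
    ultimately show "\<bar>dj y u - dj x u - Q u (y - x)\<bar> \<le> e * norm u * norm (y - x)" by simp
  qed
qed

text \<open>To first order the gradient at x is S (x - \<open>x0\<close>), and an injective linear map is bounded below.\<close>

lemma nondegenerate_critical_point_isolated:
  assumes "N = {0}"
  shows "\<exists>d>0. ball x0 d \<subseteq> U \<and> (\<forall>x\<in>ball x0 d. dj x = (\<lambda>v. 0) \<longrightarrow> x = x0)"
proof -
  have "inj S" unfolding linear_injective_0[OF linear_S] kernel_S assms by simp
  then obtain B where B: "B > 0" "\<And>u. B * norm u \<le> norm (S u)"
    using linear_inj_bounded_below_pos[OF linear_S] by blast
  then have B2: "B / 2 > 0" by simp
  obtain d where d: "d > 0" "ball x0 d \<subseteq> U"
    "\<forall>x\<in>ball x0 d. \<forall>y\<in>ball x0 d. \<forall>u.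
      \<bar>dj y u - dj x u - Q u (y - x)\<bar> \<le> B / 2 * norm u * norm (y - x)"
    using differential_expansion[OF B2] by (elim exE conjE) (rule that)
  show ?thesis
  proof (intro exI[of _ d] conjI ballI impI d(1,2))
    fix x assume x: "x \<in> ball x0 d" "dj x = (\<lambda>v. 0)"
    let ?v = "x - x0" and ?u = "S (x - x0)"
    have "\<bar>Q ?u ?v\<bar> \<le> B / 2 * norm ?u * norm ?v"
      using d(3)[rule_format, of x0 x ?u] x d(1) crit by simp
    moreover have "Q ?u ?v = norm ?u * norm ?u"
      using inner_S[of ?v ?u] Q_sym by (simp add: dot_square_norm power2_eq_square)
    ultimately have "norm ?u * norm ?u \<le> norm ?u * (B / 2 * norm ?v)" by (simp add: mult_ac)
    moreover have "norm ?u * (B / 2 * norm ?v) \<le> norm ?u * (norm ?u / 2)"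
      using B(2)[of ?v] by (intro mult_left_mono) auto
    ultimately have "norm ?u * norm ?u \<le> 0" by simp
    then have "norm ?u = 0" by (simp flip: power2_eq_square)
    then have "norm ?v = 0" using B(1) B(2)[of ?v] by (simp add: mult_le_0_iff)
    then show "x = x0" by simp
  qed
qed

end

section \<open>Rest points of a periodic Hamiltonian flow\<close>

text \<open>In a chart, w is the symplectic form, X is the Hamiltonian field of j, and \<open>x0\<close> is a rest
point. The circle action enters through the last assumption: the orbits of points near \<open>x0\<close> close
up after time 2 pi, stay in a prescribed neighbourhood, and have at all times a speed of at
most a fixed multiple of the speed at the start.\<close>

locale periodic_flow = critical_jet U j x0
  for U :: "'a::euclidean_space set" and j x0 +
  fixes w :: "'a \<Rightarrow> 'a \<Rightarrow> 'a \<Rightarrow> real" and X :: "'a \<Rightarrow> 'a"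
  assumes bil: "\<And>x. x \<in> U \<Longrightarrow> bilinear (w x)" and alt: "\<And>v. w x0 v v = 0"
    and nondeg: "\<And>u. (\<And>v. w x0 u v = 0) \<Longrightarrow> u = 0"
    and cont_w: "\<And>u v. continuous_on U (\<lambda>x. w x u v)"
    and ham: "\<And>x v. x \<in> U \<Longrightarrow> w x (X x) v = - frechet_derivative j (at x) v"
    and flow: "\<exists>C>0. \<forall>V. open V \<longrightarrow> x0 \<in> V \<longrightarrow> (\<exists>d>0. \<forall>x\<in>ball x0 d.
      \<exists>y::real\<Rightarrow>'a. y 0 = x \<and> y (2 * pi) = x \<and> (\<forall>s\<in>{0..2*pi}. y s \<in> V \<and>
        (y has_vector_derivative X (y s)) (at s) \<and> norm (X (y s)) \<le> C * norm (X x)))"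
begin

lemma bil_all: "\<forall>x\<in>U. bilinear (w x)" using bil by blast

lemma skew: "w x0 u v = - w x0 v u"
proof -
  have "w x0 (u + v) (u + v) = w x0 u u + w x0 u v + w x0 v u + w x0 v v"
    using bil[OF x0] by (simp add: bilinear_ladd bilinear_radd)
  then show ?thesis by (simp add: alt)
qed

abbreviation "W \<equiv> \<lambda>u. gradient_of (w x0 u)"

lemma linear_W: "linear W" using linear_gradient_of_bilinear bil x0 by blast
lemma inner_W: "W u \<bullet> v = w x0 u v" using inner_gradient_of bil[OF x0] by (auto simp: bilinear_def)
lemma inj_W: "inj W"
  unfolding linear_injective_0[OF linear_W] using nondeg inner_W by (metis inner_zero_left)
lemma surj_W: "surj W" by (rule linear_injective_imp_surjective[OF linear_W inj_W refl])

text \<open>Near \<open>x0\<close> the form w is close to its value at \<open>x0\<close>, where u \<open>\<mapsto>\<close> w u is injective and hence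
bounded below.\<close>

lemma field_bound_by_differential:
  "\<exists>C>0. \<exists>d>0. ball x0 d \<subseteq> U \<and>
    (\<forall>x\<in>ball x0 d. norm (X x) \<le> C * norm (gradient_of (dj x)))"
proof -
  obtain B where B: "B > 0" "\<And>u. B * norm u \<le> norm (W u)"
    using linear_inj_bounded_below_pos[OF linear_W inj_W] by blast
  have B2: "B / 2 > 0" using B by simp
  obtain d where d: "d > 0" "ball x0 d \<subseteq> U"
    "\<forall>x\<in>ball x0 d. \<forall>u v. \<bar>w x u v - w x0 u v\<bar> \<le> B / 2 * norm u * norm v"
    using bilinear_family_close[where B=w, OF open_U x0 bil_all cont_w B2] by (elim exE conjE) (rule that)
  show ?thesis
  proof (rule exI[of _ "2 / B"], intro exI[of _ d] conjI ballI d(1,2))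
    fix x assume x: "x \<in> ball x0 d"
    then have xU: "x \<in> U" using d by auto
    let ?u = "X x" and ?g = "gradient_of (dj x)"
    have "norm (W ?u) * norm (W ?u) = w x0 ?u (W ?u)"
      using inner_W[of ?u "W ?u"] by (simp add: dot_square_norm power2_eq_square)
    also have "\<dots> \<le> w x ?u (W ?u) + B / 2 * norm ?u * norm (W ?u)"
      using d(3)[rule_format, OF x, of ?u "W ?u"] by linarith
    also have "w x ?u (W ?u) = - (?g \<bullet> W ?u)"
      using ham[OF xU] inner_gradient_of[OF linear_dj[OF xU]] by simp
    also have "\<dots> \<le> norm ?g * norm (W ?u)"
      using Cauchy_Schwarz_ineq2[of ?g "W ?u"] by linarith
    finally have "norm (W ?u) * norm (W ?u) \<le> (norm ?g + B / 2 * norm ?u) * norm (W ?u)"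
      by (simp add: algebra_simps)
    then have "norm (W ?u) \<le> norm ?g + B / 2 * norm ?u"
      using norm_ge_zero[of ?g] B(1) by (cases "norm (W ?u) = 0") auto
    then show "norm (X x) \<le> 2 / B * norm ?g" using B(1) B(2)[of ?u] by (simp add: field_simps)
  qed (use B(1) in simp)
qed

lemma field_Lipschitz:
  "\<exists>C>0. \<exists>d>0. ball x0 d \<subseteq> U \<and> (\<forall>x\<in>ball x0 d. norm (X x) \<le> C * norm (x - x0))"
proof -
  obtain C d where C: "C > 0" "d > 0" "ball x0 d \<subseteq> U"
    "\<forall>x\<in>ball x0 d. norm (X x) \<le> C * norm (gradient_of (dj x))"
    using field_bound_by_differential by (elim exE conjE) (rule that)
  obtain K where K: "K > 0" "\<And>u v. norm (Q u v) \<le> K * norm u * norm v"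
    using bilinear_bounded_pos[OF bilinear_Q] by blast
  obtain d' where d': "d' > 0" "ball x0 d' \<subseteq> U"
    "\<forall>x\<in>ball x0 d'. \<forall>y\<in>ball x0 d'. \<forall>u.
      \<bar>dj y u - dj x u - Q u (y - x)\<bar> \<le> 1 * norm u * norm (y - x)"
    using differential_expansion[OF zero_less_one] by (elim exE conjE) (rule that)
  show ?thesis
  proof (rule exI[of _ "C * (K + 1)"], intro exI[of _ "min d d'"] conjI ballI)
    fix x assume x: "x \<in> ball x0 (min d d')"
    let ?g = "gradient_of (dj x)"
    have xU: "x \<in> U" using x C(3) by auto
    have "norm ?g * norm ?g = dj x ?g"
      using inner_gradient_of[OF linear_dj[OF xU], of ?g] by (simp add: dot_square_norm power2_eq_square)
    also have "\<dots> \<le> Q ?g (x - x0) + norm ?g * norm (x - x0)"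
      using d'(3)[rule_format, of x0 x ?g] x d'(1) crit by simp
    also have "\<dots> \<le> (K + 1) * norm (x - x0) * norm ?g"
      using K(2)[of ?g "x - x0"] by (simp add: algebra_simps)
    finally have "norm ?g \<le> (K + 1) * norm (x - x0)"
      using K(1) by (cases "norm ?g = 0") auto
    then have "C * norm ?g \<le> C * ((K + 1) * norm (x - x0))"
      using C(1) by (intro mult_left_mono) auto
    then show "norm (X x) \<le> C * (K + 1) * norm (x - x0)"
      using C(4)[rule_format, of x] x by (simp add: mult.assoc)
  qed (use C(1-3) K(1) d'(1) in auto)
qed

text \<open>At the point y s of the orbit of x, the functional w (X (y s)) is -dj (y s). A controlled loop is one
along which w may be frozen at \<open>x0\<close> and dj may be expanded to first order at x, with an error that is
small relative to the speed at x.\<close>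

definition controlled_loop :: "real \<Rightarrow> 'a \<Rightarrow> (real \<Rightarrow> 'a) \<Rightarrow> bool" where
  "controlled_loop e x y \<longleftrightarrow> y 0 = x \<and> y (2 * pi) = x \<and>
     (\<forall>s\<in>{0..2*pi}. (y has_vector_derivative X (y s)) (at s) \<and>
        (\<forall>u. \<bar>w x0 (X (y s)) u + dj x u + Q u (y s - x)\<bar> \<le> e * norm (X x) * norm u))"

lemma controlled_loopD:
  assumes "controlled_loop e x y"
  shows "y 0 = x" "y (2 * pi) = x"
    and "\<And>s. s \<in> {0..2*pi} \<Longrightarrow> (y has_vector_derivative X (y s)) (at s)"
    and "\<And>s u. s \<in> {0..2*pi} \<Longrightarrow>
      \<bar>w x0 (X (y s)) u + dj x u + Q u (y s - x)\<bar> \<le> e * norm (X x) * norm u"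
  using assms by (auto simp: controlled_loop_def)

text \<open>The orbit of x has a length of at most a constant times norm (X x), by the bound on the speed. Hence the errors of
freezing w and of expanding dj are both of the form e times norm (X x).\<close>

lemma flow_estimate:
  assumes e: "e > 0"
  shows "\<exists>d>0. ball x0 d \<subseteq> U \<and> (\<forall>x\<in>ball x0 d. \<exists>y. controlled_loop e x y)"
proof -
  obtain C where C: "C > 0" and fl: "\<forall>V. open V \<longrightarrow> x0 \<in> V \<longrightarrow> (\<exists>d>0. \<forall>x\<in>ball x0 d.
      \<exists>y::real\<Rightarrow>'a. y 0 = x \<and> y (2 * pi) = x \<and> (\<forall>s\<in>{0..2*pi}. y s \<in> V \<and>
        (y has_vector_derivative X (y s)) (at s) \<and> norm (X (y s)) \<le> C * norm (X x)))"
    using flow by (elim exE conjE) (rule that)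
  define e' where "e' = e / (C + 2 * pi * C)"
  have pos: "C + 2 * pi * C > 0" using C by (simp add: add_pos_pos)
  have e': "e' > 0" "e' * (C + 2 * pi * C) = e" using e pos by (auto simp: e'_def)
  obtain d1 where d1: "d1 > 0" "ball x0 d1 \<subseteq> U"
    "\<forall>x\<in>ball x0 d1. \<forall>u v. \<bar>w x u v - w x0 u v\<bar> \<le> e' * norm u * norm v"
    using bilinear_family_close[where B=w, OF open_U x0 bil_all cont_w e'(1)] by (elim exE conjE) (rule that)
  obtain d2 where d2: "d2 > 0" "ball x0 d2 \<subseteq> U"
    "\<forall>x\<in>ball x0 d2. \<forall>y\<in>ball x0 d2. \<forall>u.
      \<bar>dj y u - dj x u - Q u (y - x)\<bar> \<le> e' * norm u * norm (y - x)"
    using differential_expansion[OF e'(1)] by (elim exE conjE) (rule that)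
  let ?V = "ball x0 (min d1 d2)"
  obtain d where d: "d > 0" "\<forall>x\<in>ball x0 d.
    \<exists>y::real\<Rightarrow>'a. y 0 = x \<and> y (2 * pi) = x \<and> (\<forall>s\<in>{0..2*pi}. y s \<in> ?V \<and>
      (y has_vector_derivative X (y s)) (at s) \<and> norm (X (y s)) \<le> C * norm (X x))"
    using mp[OF mp[OF spec[OF fl, of ?V] open_ball]] d1(1) d2(1) by auto
  show ?thesis
  proof (intro exI[of _ "min d d1"] conjI ballI)
    show "0 < min d d1" using d d1 by simp
    show "ball x0 (min d d1) \<subseteq> U" using d1 by auto
    fix x assume x: "x \<in> ball x0 (min d d1)"
    obtain y where y: "y 0 = x" "y (2 * pi) = x"
      and ball: "\<forall>s\<in>{0..2*pi}. y s \<in> ?V \<and>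
        (y has_vector_derivative X (y s)) (at s) \<and> norm (X (y s)) \<le> C * norm (X x)"
      using bspec[OF d(2), of x] x by auto
    have V: "y s \<in> ?V" and der: "(y has_vector_derivative X (y s)) (at s)"
      and speed: "norm (X (y s)) \<le> C * norm (X x)" if "s \<in> {0..2*pi}" for s
      using bspec[OF ball that] by simp_all
    have near: "norm (y s - x) \<le> 2 * pi * C * norm (X x)" if s: "s \<in> {0..2*pi}" for s
    proof -
      have "norm (y s - y 0 - s *\<^sub>R 0) \<le> C * norm (X x) * s"
        by (rule drift_bound[OF der _ s]) (simp_all add: speed)
      also have "\<dots> \<le> C * norm (X x) * (2 * pi)" using s C by (intro mult_left_mono) auto
      finally show ?thesis using y(1) by (simp add: mult_ac)
    qed
    have "\<bar>w x0 (X (y s)) u + dj x u + Q u (y s - x)\<bar> \<le> e * norm (X x) * norm u"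
      if s: "s \<in> {0..2*pi}" for s u
    proof -
      have ys: "y s \<in> ball x0 d1" "y s \<in> ball x0 d2" "x \<in> ball x0 d2"
        using V[OF s] V[of 0] y(1) by auto
      have "w (y s) (X (y s)) u = - dj (y s) u" using ham d1(2) ys(1) by auto
      then have "\<bar>w x0 (X (y s)) u + dj x u + Q u (y s - x)\<bar>
          \<le> e' * norm (X (y s)) * norm u + e' * norm u * norm (y s - x)"
        using d1(3)[rule_format, OF ys(1), of "X (y s)" u] d2(3)[rule_format, OF ys(3,2), of u] by linarith
      also have "\<dots> \<le> e' * (C * norm (X x)) * norm u + e' * norm u * (2 * pi * C * norm (X x))"
        using speed[OF s] near[OF s] e'(1) C by (intro add_mono mult_mono) auto
      also have "\<dots> = e' * (C + 2 * pi * C) * norm (X x) * norm u" by (simp add: algebra_simps)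
      finally show ?thesis using e'(2) by simp
    qed
    then show "\<exists>y. controlled_loop e x y"
      using y der unfolding controlled_loop_def by blast
  qed
qed

lemma has_derivative_w_along:
  assumes "(y has_vector_derivative v) (at s)"
  shows "((\<lambda>s. w x0 (y s) u) has_vector_derivative w x0 v u) (at s)"
proof -
  have "linear (\<lambda>v. w x0 v u)" using bil[OF x0] by (simp add: bilinear_def)
  then show ?thesis
    using bounded_linear.has_vector_derivative[OF _ assms] linear_conv_bounded_linear by blast
qed

text \<open>For u in N the term with Q disappears, so w \<open>x0\<close> (y s) u moves with the nearly constant velocity -dj x u. Since
it returns to its initial value, this velocity is small.\<close>

lemma differential_on_kernel_small:
  assumes e: "e > 0"
  shows "\<exists>d>0. ball x0 d \<subseteq> U \<and> (\<forall>x\<in>ball x0 d. \<forall>u\<in>N. \<bar>dj x u\<bar> \<le> e * norm (X x) * norm u)"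
proof -
  obtain d where d: "d > 0" "ball x0 d \<subseteq> U" "\<forall>x\<in>ball x0 d. \<exists>y. controlled_loop e x y"
    using flow_estimate[OF e] by (elim exE conjE) (rule that)
  show ?thesis
  proof (intro exI[of _ d] conjI ballI d(1,2))
    fix x u assume x: "x \<in> ball x0 d" and u: "u \<in> N"
    from bspec[OF d(3) x] obtain y where y: "controlled_loop e x y" ..
    note y = controlled_loopD[OF y]
    have "norm (w x0 (y (2*pi)) u - w x0 (y 0) u - (2*pi) *\<^sub>R (- dj x u)) \<le> e * norm (X x) * norm u * (2*pi)"
    proof (rule drift_bound[where b="2*pi"])
      fix s assume s: "s \<in> {0..2*pi}"
      show "((\<lambda>s. w x0 (y s) u) has_vector_derivative w x0 (X (y s)) u) (at s)"
        using has_derivative_w_along[OF y(3)[OF s]] .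
      show "norm (w x0 (X (y s)) u - - dj x u) \<le> e * norm (X x) * norm u"
        using y(4)[OF s, of u] u by simp
    qed simp
    then have "2 * pi * \<bar>dj x u\<bar> \<le> 2 * pi * (e * norm (X x) * norm u)"
      using y(1,2) by (simp add: abs_mult mult_ac)
    then show "\<bar>dj x u\<bar> \<le> e * norm (X x) * norm u" by simp
  qed
qed

text \<open>Let L be the linearisation of X at \<open>x0\<close>. The hypotheses say that L maps u to -a
and a to 0. Along the linearised orbit y of v, the product w \<open>x0\<close> (y s) a is then constant, while
w \<open>x0\<close> (y s) u changes at the constant rate -Q u v, which contradicts periodicity unless Q u v = 0. The proof carries this out
for the true orbits of the points \<open>x0\<close> + t v with t small, up to errors of order e t.\<close>

lemma nilpotent_imp_zero:
  assumes ua: "\<And>v. Q u v = w x0 a v" and a: "a \<in> N"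
  shows "a = 0"
proof -
  obtain L dL where L: "L > 0" "dL > 0" "\<forall>x\<in>ball x0 dL. norm (X x) \<le> L * norm (x - x0)"
    using field_Lipschitz by (elim exE conjE) (rule that)
  \<comment> \<open>K collects the constants in the estimate of Q u v; it is independent of e, so e can tend to 0.\<close>
  define K where "K = (4 * pi * norm a + norm u) * L + norm u"
  have Q_small: "\<bar>Q u v\<bar> \<le> e * (K * norm v)" if e: "e > 0" for e v
  proof -
    obtain d1 where d1: "d1 > 0" "\<forall>x\<in>ball x0 d1. \<exists>y. controlled_loop e x y"
      using flow_estimate[OF e] by (elim exE conjE) (rule that)
    obtain d2 where d2: "d2 > 0" "\<forall>x\<in>ball x0 d2. \<forall>u\<in>N. \<bar>dj x u\<bar> \<le> e * norm (X x) * norm u"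
      using differential_on_kernel_small[OF e] by (elim exE conjE) (rule that)
    obtain d3 where d3: "d3 > 0" "\<forall>x\<in>ball x0 d3. \<forall>y\<in>ball x0 d3. \<forall>u.
        \<bar>dj y u - dj x u - Q u (y - x)\<bar> \<le> e * norm u * norm (y - x)"
      using differential_expansion[OF e] by (elim exE conjE) (rule that)
    define r where "r = min (min d1 d2) (min d3 dL)"
    \<comment> \<open>The step t is only required to keep x in the ball of radius r; adding 1 covers v = 0.\<close>
    define t where "t = r / 2 / (norm v + 1)"
    have r: "r > 0" using d1 d2 d3 L by (simp add: r_def)
    have nv: "norm v + 1 > 0" by (simp add: add_nonneg_pos)
    have t: "t > 0" "t * norm v < r"
      using r nv by (auto simp: t_def field_simps intro: add_nonneg_pos)
    define x where "x = x0 + t *\<^sub>R v"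
    have xx0: "x - x0 = t *\<^sub>R v" "norm (x - x0) = t * norm v" using t by (auto simp: x_def)
    have "dist x0 x < r" using t xx0(2) by (simp add: dist_norm norm_minus_commute)
    then have x: "x \<in> ball x0 d1" "x \<in> ball x0 d2" "x \<in> ball x0 d3" "x \<in> ball x0 dL"
      by (auto simp: r_def)
    from bspec[OF d1(2) x(1)] obtain y where y: "controlled_loop e x y" ..
    note y = controlled_loopD[OF y]
    let ?n = "norm (X x)"
    have drift_a: "\<bar>w x0 (y s - x) a\<bar> \<le> 4 * pi * e * ?n * norm a" if s: "s \<in> {0..2*pi}" for s
    proof -
      have "norm (w x0 (y s) a - w x0 (y 0) a - s *\<^sub>R 0) \<le> 2 * e * ?n * norm a * s"
      proof (rule drift_bound[OF _ _ s])
        fix s assume s: "s \<in> {0..2*pi}"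
        show "((\<lambda>s. w x0 (y s) a) has_vector_derivative w x0 (X (y s)) a) (at s)"
          using has_derivative_w_along[OF y(3)[OF s]] .
        show "norm (w x0 (X (y s)) a - 0) \<le> 2 * e * ?n * norm a"
          using y(4)[OF s, of a] d2(2)[rule_format, OF x(2) a] a by simp
      qed
      also have "\<dots> \<le> 2 * e * ?n * norm a * (2 * pi)" using s e by (intro mult_left_mono) auto
      finally show ?thesis using bilinear_lsub[OF bil[OF x0]] y(1) by (simp add: mult_ac)
    qed
    have "norm (w x0 (y (2*pi)) u - w x0 (y 0) u - (2*pi) *\<^sub>R (- dj x u))
        \<le> (4 * pi * norm a + norm u) * e * ?n * (2*pi)"
    proof (rule drift_bound[where b="2*pi"])
      fix s assume s: "s \<in> {0..2*pi}"
      show "((\<lambda>s. w x0 (y s) u) has_vector_derivative w x0 (X (y s)) u) (at s)"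
        using has_derivative_w_along[OF y(3)[OF s]] .
      have "Q u (y s - x) = - w x0 (y s - x) a" using ua skew by metis
      then show "norm (w x0 (X (y s)) u - - dj x u) \<le> (4 * pi * norm a + norm u) * e * ?n"
        using y(4)[OF s, of u] drift_a[OF s] by (simp add: algebra_simps)
    qed simp
    then have "2 * pi * \<bar>dj x u\<bar> \<le> 2 * pi * ((4 * pi * norm a + norm u) * e * ?n)"
      using y(1,2) by (simp add: abs_mult mult_ac)
    then have "\<bar>dj x u\<bar> \<le> (4 * pi * norm a + norm u) * e * ?n" by simp
    also have "\<dots> \<le> (4 * pi * norm a + norm u) * e * (L * (t * norm v))"
      using L(3)[rule_format, OF x(4)] xx0(2) e by (intro mult_left_mono) auto
    finally have "\<bar>dj x u\<bar> \<le> (4 * pi * norm a + norm u) * e * (L * (t * norm v))" .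
    moreover have "\<bar>dj x u - Q u (t *\<^sub>R v)\<bar> \<le> e * norm u * (t * norm v)"
      using d3(2)[rule_format, of x0 x u] x(3) d3(1) crit xx0(2) unfolding xx0(1)[symmetric] by simp
    moreover have "Q u (t *\<^sub>R v) = t * Q u v" using linear_scale[OF linear_Q] by simp
    ultimately have "\<bar>t * Q u v\<bar> \<le> (4 * pi * norm a + norm u) * e * (L * (t * norm v)) + e * norm u * (t * norm v)"
      by linarith
    also have "\<dots> = t * (e * (K * norm v))" by (simp add: K_def algebra_simps)
    finally show ?thesis using t(1) by (simp add: abs_mult)
  qed
  have "Q u v = 0" for v
  proof (rule ccontr)
    assume "Q u v \<noteq> 0"
    define M where "M = K * norm v + 1"
    define e where "e = \<bar>Q u v\<bar> / (2 * M)"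
    have M: "M > 0" using L(1) by (simp add: M_def K_def add_nonneg_pos)
    have e: "e > 0" using M \<open>Q u v \<noteq> 0\<close> by (simp add: e_def)
    have "\<bar>Q u v\<bar> \<le> e * (K * norm v)" using Q_small[OF e] .
    also have "\<dots> \<le> e * M" using e by (simp add: M_def)
    also have "\<dots> = \<bar>Q u v\<bar> / 2" using M by (simp add: e_def)
    finally show False using \<open>Q u v \<noteq> 0\<close> by simp
  qed
  then show "a = 0" using ua nondeg by metis
qed

text \<open>The range of the symmetric map S is the orthogonal complement of its kernel.\<close>

lemma orthogonal_kernel_in_range:
  assumes g: "\<And>a. a \<in> N \<Longrightarrow> g \<bullet> a = 0"
  shows "g \<in> range S"
proof -
  have sub: "subspace (range S)" by (rule linear_subspace_image[OF linear_S subspace_UNIV])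
  obtain y z where y: "y \<in> span (range S)" and z: "\<And>v. v \<in> span (range S) \<Longrightarrow> orthogonal z v"
    and g_eq: "g = y + z"
    by (rule orthogonal_subspace_decomp_exists[of "range S" g]) blast
  have "Q z u = 0" for u
  proof -
    have "Q z u = S u \<bullet> z" unfolding inner_S by (rule Q_sym)
    also have "\<dots> = 0"
      using z[OF span_base[OF rangeI[of S u]]] by (simp only: orthogonal_def inner_commute)
    finally show ?thesis .
  qed
  then have "g \<bullet> z = 0" using g by blast
  moreover have "y \<bullet> z = 0" using z[OF y] by (simp add: orthogonal_def inner_commute)
  ultimately have "z = 0" using g_eq by (simp add: inner_add_left)
  then show ?thesis using y g_eq unfolding span_eq_iff[THEN iffD2, OF sub] by simp
qed

text \<open>If a in N is w-orthogonal to N, then w a vanishes on the kernel of Q and is therefore of the form Q u. This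
is the situation excluded by the previous argument.\<close>

lemma kernel_symplectic:
  assumes a: "a \<in> N" and "\<And>v. v \<in> N \<Longrightarrow> w x0 a v = 0"
  shows "a = 0"
proof -
  have "W a \<bullet> v = 0" if "v \<in> N" for v using assms(2)[OF that] by (simp only: inner_W)
  then have "W a \<in> range S" by (rule orthogonal_kernel_in_range)
  then obtain u where u: "W a = S u" by (rule imageE)
  have "Q u v = w x0 a v" for v
  proof -
    have "Q u v = S u \<bullet> v" by (simp only: inner_S)
    also have "\<dots> = w x0 a v" by (simp only: u[symmetric] inner_W)
    finally show ?thesis .
  qed
  then show ?thesis using a by (rule nilpotent_imp_zero)
qed

text \<open>A symplectic subspace has even dimension. In dimension 1 a spanning vector is w-orthogonal to itself. In
dimension 3 the w-orthogonal complement contains a vector b outside of N, and b would be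
w-orthogonal to N and to itself, that is, to everything.\<close>

lemma dim_kernel:
  assumes "DIM('a) = 4"
  shows "dim N \<in> {0, 2, 4}"
proof -
  have "dim N \<noteq> 1"
  proof
    assume "dim N = 1"
    obtain B where B: "B \<subseteq> N" "independent B" "N \<subseteq> span B" "card B = 1"
      using basis_exists[of N] unfolding \<open>dim N = 1\<close> by blast
    then obtain a where a: "B = {a}" using card_1_singletonE by blast
    have "w x0 a v = 0" if "v \<in> N" for v
    proof -
      have "v \<in> range (\<lambda>k. k *\<^sub>R a)" using that B(3) a by (auto simp: span_singleton)
      then show ?thesis using bilinear_rmul[OF bil[OF x0]] alt by auto
    qed
    then have "a = 0" using kernel_symplectic B(1) a by blast
    then have "N \<subseteq> {0}" using B(3) a by simp
    then show False using \<open>dim N = 1\<close> dim_subset[of N "{0}"] by simp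
  qed
  moreover have "dim N \<noteq> 3"
  proof
    assume d3: "dim N = 3"
    then have "dim N < DIM('a)" using assms by simp
    then obtain n where n: "n \<noteq> 0" "\<And>y. y \<in> span N \<Longrightarrow> orthogonal n y"
      using orthogonal_to_subspace_exists by blast
    obtain b where b: "W b = n" using surj_W by (metis surjD)
    have wb: "w x0 b v = 0" if "v \<in> N" for v
      using n(2)[OF span_base[OF that]] inner_W[of b v] b by (simp add: orthogonal_def)
    have "b \<noteq> 0" using n b linear_0[OF linear_W] by auto
    then have "b \<notin> N" using kernel_symplectic[of b] wb by blast
    then have "b \<notin> span N" unfolding span_N .
    then have "dim (insert b N) = DIM('a)" using d3 assms by (simp add: dim_insert)
    then have full: "span (insert b N) = UNIV" by (simp add: dim_eq_full)
    have "linear (w x0 b)" using bil[OF x0] by (simp add: bilinear_def)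
    then have "w x0 b v = 0" for v
      by (rule linear_eq_0_on_span[where b="insert b N"]) (use wb alt full in auto)
    then show False using nondeg \<open>b \<noteq> 0\<close> by blast
  qed
  moreover have "dim N \<le> 4" using dim_subset_UNIV[of N] assms by simp
  ultimately have "dim N = 0 \<or> dim N = 2 \<or> dim N = 4" by linarith
  then show ?thesis by blast
qed

text \<open>If dj x vanishes on the orthogonal complement of N, its gradient g lies in N. The periodicity estimate
with u = g then bounds the square of the length of g by half of itself.\<close>

lemma critical_if_transverse_part_zero:
  "\<exists>d>0. ball x0 d \<subseteq> U \<and> (\<forall>x\<in>ball x0 d.
    (\<forall>v. (\<forall>a\<in>N. orthogonal a v) \<longrightarrow> dj x v = 0) \<longrightarrow> dj x = (\<lambda>v. 0))"
proof -
  obtain C d1 where C: "C > 0" "d1 > 0" "ball x0 d1 \<subseteq> U"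
    "\<forall>x\<in>ball x0 d1. norm (X x) \<le> C * norm (gradient_of (dj x))"
    using field_bound_by_differential by (elim exE conjE) (rule that)
  have C2: "1 / (2 * C) > 0" using C by simp
  obtain d2 where d2: "d2 > 0" "ball x0 d2 \<subseteq> U"
    "\<forall>x\<in>ball x0 d2. \<forall>u\<in>N. \<bar>dj x u\<bar> \<le> 1 / (2 * C) * norm (X x) * norm u"
    using differential_on_kernel_small[OF C2] by (elim exE conjE) (rule that)
  show ?thesis
  proof (intro exI[of _ "min d1 d2"] conjI ballI impI)
    fix x assume x: "x \<in> ball x0 (min d1 d2)" and perp: "\<forall>v. (\<forall>a\<in>N. orthogonal a v) \<longrightarrow> dj x v = 0"
    have xU: "x \<in> U" using x C(3) by auto
    let ?g = "gradient_of (dj x)"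
    have in_g: "?g \<bullet> v = dj x v" for v using inner_gradient_of[OF linear_dj[OF xU]] .
    obtain y z where yz: "y \<in> span N" "\<And>v. v \<in> span N \<Longrightarrow> orthogonal z v" "?g = y + z"
      by (rule orthogonal_subspace_decomp_exists[of N ?g]) blast
    have "dj x z = 0" by (rule perp[rule_format]) (use yz(2)[OF span_base] in \<open>auto simp: orthogonal_commute\<close>)
    then have "?g \<bullet> z = 0" using in_g by simp
    moreover have "y \<bullet> z = 0" using yz(2)[OF yz(1)] by (simp add: orthogonal_def inner_commute)
    ultimately have "z = 0" using yz(3) by (simp add: inner_add_left)
    then have gN: "?g \<in> N" using yz(1,3) unfolding span_N by simp
    have "norm ?g * norm ?g = dj x ?g"
      using in_g[of ?g] by (simp add: dot_square_norm power2_eq_square)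
    also have "\<dots> \<le> 1 / (2 * C) * norm (X x) * norm ?g" using d2(3)[rule_format, OF _ gN, of x] x by simp
    also have "\<dots> \<le> 1 / (2 * C) * (C * norm ?g) * norm ?g"
      using C(1) C(4)[rule_format, of x] x by (intro mult_right_mono mult_left_mono) auto
    also have "\<dots> = norm ?g * norm ?g / 2" using C(1) by simp
    finally have "norm ?g * norm ?g \<le> 0" by simp
    then have "?g = 0" by (simp flip: power2_eq_square)
    then show "dj x = (\<lambda>v. 0)" using in_g by (metis inner_zero_left)
  qed (use C(1-3) d2(1) in auto)
qed

end

section \<open>The critical set as a surface\<close>

lemma smooth_inverse_function_theorem:
  fixes f :: "real ^ 'n \<Rightarrow> real ^ 'n"
  assumes U: "open U" "x0 \<in> U" and f: "\<And>k. Ck_on k f U"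
    and inj: "\<And>v. frechet_derivative f (at x0) v = 0 \<Longrightarrow> v = 0"
  obtains V V' g where "open V" "V \<subseteq> U" "x0 \<in> V" "open V'" "f x0 \<in> V'" "homeomorphism V V' f g"
    and "\<And>k. Ck_on k g V'"
proof -
  let ?D = "\<lambda>x. frechet_derivative f (at x)"
  let ?B = "\<lambda>x. Blinfun (?D x)"
  have D: "(f has_derivative ?D x) (at x)" if "x \<in> U" for x
    using Ck_on_has_derivative[OF f that] .
  have B: "blinfun_apply (?B x) = ?D x" if "x \<in> U" for x
    by (rule bounded_linear_Blinfun_apply[OF has_derivative_bounded_linear[OF D[OF that]]])
  have der: "(f has_derivative blinfun_apply (?B x)) (at x)" if "x \<in> U" for x
    using D B that by simp
  have "isCont ?B x" if x: "x \<in> U" for x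
  proof (rule continuous_blinfun_componentwiseI1)
    fix i :: "real ^ 'n"
    have "Ck_on 0 (\<lambda>x. ?D x i) U" using f[of "Suc 0"] by simp
    then have "continuous_on U (\<lambda>x. ?D x i)" by simp
    then have "continuous_on U (\<lambda>x. blinfun_apply (?B x) i)"
      by (rule continuous_on_eq) (simp add: B)
    then show "isCont (\<lambda>x. blinfun_apply (?B x) i) x" using U x continuous_on_eq_continuous_at by blast
  qed
  then have cont: "continuous_on U ?B" by (simp add: continuous_at_imp_continuous_on)
  have lin: "linear (?D x0)" using D[OF U(2)] has_derivative_linear by blast
  then have "inj (?D x0)" using inj linear_injective_0 by blast
  then obtain h where h: "linear h" "h \<circ> ?D x0 = id" using linear_injective_left_inverse[OF lin] by blast
  have "Blinfun h o\<^sub>L ?B x0 = id_blinfun"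
    using h B[OF U(2)] by (intro blinfun_eqI)
      (simp add: bounded_linear_Blinfun_apply linear_conv_bounded_linear[symmetric] fun_eq_iff)
  then obtain V V' g g' where V: "open V" "V \<subseteq> U" "x0 \<in> V" "open V'" "f x0 \<in> V'" "homeomorphism V V' f g"
    "\<And>y. y \<in> V' \<Longrightarrow> (g has_derivative g' y) (at y)"
    using inverse_function_theorem[OF U(1) der cont U(2)] by metis
  have "Ck_on k g V'" for k
    by (rule Ck_on_inverse_function[OF V(4) V(1) _ Ck_on_subset[OF f V(2)] V(7)])
      (use V(6) in \<open>auto simp: homeomorphism_def\<close>)
  then show ?thesis using that V by blast
qed

text \<open>The first two components of F are coordinates along N, and the last two are the values of dj on a
basis of the complement of N. Where the last two vanish, dj vanishes altogether, by the
preceding lemma.\<close>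

lemma critical_set_slice:
  fixes x0 :: "real ^ 4"
  assumes "periodic_flow U j x0 w X"
    and d2: "dim {u. \<forall>v. frechet_derivative (\<lambda>x. frechet_derivative j (at x) u) (at x0) v = 0} = 2"
  obtains V and F :: "real ^ 4 \<Rightarrow> real ^ 4" and G r where "open V" "x0 \<in> V" "V \<subseteq> U" "r > 0" "homeomorphism V (ball (F x0) r) F G"
    and "\<And>k. Ck_on k F V" "\<And>k. Ck_on k G (ball (F x0) r)"
    and "\<And>x. x \<in> V \<Longrightarrow> frechet_derivative j (at x) = (\<lambda>v. 0) \<longleftrightarrow> F x $ 3 = 0 \<and> F x $ 4 = (0::real)"
proof -
  interpret periodic_flow U j x0 w X by fact
  let ?P = "{y. \<forall>a\<in>N. orthogonal a y}"
  have "dim ?P + dim N = 4"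
    using dim_subspace_orthogonal_to_vectors[OF subspace_N subspace_UNIV] by simp
  then have dP: "dim ?P = 2" using d2 by simp
  have two: "\<exists>a b. span {a, b} = S" if "subspace S" "dim S = 2" for S :: "(real^4) set"
  proof -
    obtain B where B: "B \<subseteq> S" "independent B" "S \<subseteq> span B" "card B = dim S" by (rule basis_exists)
    then have "span B = S" using that span_minimal by blast
    then show ?thesis using B(4) that(2) card_2_iff by metis
  qed
  obtain e1 e2 where N: "span {e1, e2} = N" using two[OF subspace_N] d2 by blast
  obtain e3 e4 where P: "span {e3, e4} = ?P" using two[OF subspace_orthogonal_to_vectors dP] by blast
  have zero_on_P: "f v = 0" if "linear f" "f e3 = 0" "f e4 = 0" "v \<in> ?P" for f :: "real^4 \<Rightarrow> real" and v
    using linear_eq_0_on_span[OF that(1), of "{e3, e4}" v] that P by auto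
  define F where "F x = ((\<chi> i. if i = 1 then x \<bullet> e1 else if i = 2 then x \<bullet> e2
    else if i = 3 then dj x e3 else dj x e4) :: real ^ 4)" for x
  have F: "F x $ 1 = x \<bullet> e1" "F x $ 2 = x \<bullet> e2" "F x $ 3 = dj x e3" "F x $ 4 = dj x e4" for x
    by (simp_all add: F_def)
  have smooth_F: "Ck_on k F U" for k
  proof (rule Ck_on_vec[OF open_U])
    fix i :: 4
    have "Ck_on k (\<lambda>x. x \<bullet> e) U" for e :: "real^4" by (rule Ck_on_linear[OF open_U bounded_linear_inner_left])
    then show "Ck_on k (\<lambda>x. F x $ i) U"
      using exhaust_4[of i] smooth_dj by (auto simp: F)
  qed
  have F': "frechet_derivative F (at x0) v $ i = D v"
    if "((\<lambda>x. F x $ i) has_derivative D) (at x0)" for D v i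
    using has_derivative_unique[OF that bounded_linear.has_derivative[OF bounded_linear_vec_nth
          Ck_on_has_derivative[OF smooth_F x0]]] by metis
  have inj: "v = 0" if v: "frechet_derivative F (at x0) v = 0" for v
  proof -
    have dot: "((\<lambda>x. x \<bullet> e) has_derivative (\<lambda>v. v \<bullet> e)) (at x0)" for e :: "real^4"
      by (auto intro!: derivative_eq_intros)
    have z: "v \<bullet> e1 = 0" "v \<bullet> e2 = 0" "Q e3 v = 0" "Q e4 v = 0"
      using F'[of 1, unfolded F, OF dot] F'[of 2, unfolded F, OF dot]
        F'[of 3, unfolded F, OF dj_has_derivative[OF x0]] F'[of 4, unfolded F, OF dj_has_derivative[OF x0]] v
      by (metis zero_index)+
    have "Q u v = 0" for u
    proof -
      obtain y z where yz: "y \<in> span N" "\<And>v. v \<in> span N \<Longrightarrow> orthogonal z v" "u = y + z"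
        by (rule orthogonal_subspace_decomp_exists[of N u]) blast
      have "y \<in> N" using yz(1) unfolding span_N .
      moreover have "z \<in> ?P" using yz(2)[OF span_base] by (auto simp: orthogonal_commute)
      moreover have "linear (\<lambda>z. Q z v)" using bilinear_Q by (simp add: bilinear_def)
      ultimately show ?thesis
        using zero_on_P[of "\<lambda>z. Q z v" z] z bilinear_ladd[OF bilinear_Q] yz(3) by simp
    qed
    then have "v \<in> span {e1, e2}" using N Q_sym by simp
    moreover have "linear (\<lambda>x. v \<bullet> x)" by (simp add: linear_iff inner_add_right)
    ultimately have "v \<bullet> v = 0"
      using linear_eq_0_on_span[of "\<lambda>x. v \<bullet> x" "{e1, e2}" v] z(1,2) by auto
    then show ?thesis by simp
  qed
  obtain d where d: "d > 0" "ball x0 d \<subseteq> U"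
    "\<forall>x\<in>ball x0 d. (\<forall>v. (\<forall>a\<in>N. orthogonal a v) \<longrightarrow> dj x v = 0) \<longrightarrow> dj x = (\<lambda>v. 0)"
    using critical_if_transverse_part_zero by (elim exE conjE) (rule that)
  have "x0 \<in> ball x0 d" using d by simp
  from smooth_inverse_function_theorem[OF open_ball this Ck_on_subset[OF smooth_F d(2)] inj]
  obtain V V' G where V: "open V" "V \<subseteq> ball x0 d" "x0 \<in> V" "open V'" "F x0 \<in> V'" "homeomorphism V V' F G"
    and G: "\<And>k. Ck_on k G V'" by blast
  obtain r where r: "r > 0" "ball (F x0) r \<subseteq> V'" using V(4,5) open_contains_ball by blast
  define V1 where "V1 = V \<inter> F -` ball (F x0) r"
  have contF: "continuous_on V F" using V(6) by (simp add: homeomorphism_def)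
  show ?thesis
  proof (rule that[of V1 r F G])
    show "open V1" unfolding V1_def by (rule continuous_open_preimage[OF contF V(1) open_ball])
    show "x0 \<in> V1" using V r by (simp add: V1_def)
    show "V1 \<subseteq> U" using V(2) d(2) by (auto simp: V1_def)
    show "homeomorphism V1 (ball (F x0) r) F G"
    proof (rule homeomorphism_of_subsets[OF V(6)])
      show "F ` V1 = ball (F x0) r"
      proof
        show "F ` V1 \<subseteq> ball (F x0) r" unfolding V1_def by blast
        show "ball (F x0) r \<subseteq> F ` V1"
        proof
          fix y assume y: "y \<in> ball (F x0) r"
          then have "y \<in> V'" using r(2) by blast
          then have "G y \<in> V" "F (G y) = y"
            using V(6) unfolding homeomorphism_def by blast+
          then show "y \<in> F ` V1" using y unfolding V1_def by (metis IntI image_eqI vimageI)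
        qed
      qed
    qed (use r(2) in \<open>auto simp: V1_def\<close>)
    show "Ck_on k F V1" for k
      by (rule Ck_on_subset[OF smooth_F]) (use V(2) d(2) in \<open>auto simp: V1_def\<close>)
    show "Ck_on k G (ball (F x0) r)" for k
      by (rule Ck_on_subset[OF G r(2)])
    fix x assume "x \<in> V1"
    then have x: "x \<in> ball x0 d" using V(2) by (auto simp: V1_def)
    then have lin: "linear (dj x)" using d(2) linear_dj by blast
    show "dj x = (\<lambda>v. 0) \<longleftrightarrow> F x $ 3 = 0 \<and> F x $ 4 = 0"
      unfolding F using d(3)[rule_format, OF x] zero_on_P[OF lin] by auto
  qed (use r in simp)
qed

section \<open>Functions and Hamiltonian fields in charts\<close>

locale atlas =
  fixes \<A> :: "('m::{t2_space,second_countable_topology}, 'n::finite) chart set"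
  assumes atlas: "smooth_atlas \<A>"
begin

lemma chart_hom: "c \<in> \<A> \<Longrightarrow> homeomorphism (dom_of c) (range_of c) (coord c) (param c)"
  using atlas by (auto simp: smooth_atlas_def is_chart_def)

lemma open_dom: "c \<in> \<A> \<Longrightarrow> open (dom_of c)"
  and open_range: "c \<in> \<A> \<Longrightarrow> open (range_of c)"
  using atlas by (auto simp: smooth_atlas_def is_chart_def)

lemma param_coord: "c \<in> \<A> \<Longrightarrow> p \<in> dom_of c \<Longrightarrow> param c (coord c p) = p"
  and coord_param: "c \<in> \<A> \<Longrightarrow> x \<in> range_of c \<Longrightarrow> coord c (param c x) = x"
  using homeomorphism_apply1[OF chart_hom] homeomorphism_apply2[OF chart_hom] by blast+

lemma param_in_dom: "c \<in> \<A> \<Longrightarrow> x \<in> range_of c \<Longrightarrow> param c x \<in> dom_of c"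
  using homeomorphism_image2[OF chart_hom] by blast

lemma cont_param: "c \<in> \<A> \<Longrightarrow> continuous_on (range_of c) (param c)"
  using homeomorphism_cont2[OF chart_hom] .

lemma chart_around: obtains c where "c \<in> \<A>" "p \<in> dom_of c"
proof -
  have "p \<in> (\<Union>c\<in>\<A>. dom_of c)" using atlas unfolding smooth_atlas_def by blast
  then show thesis using that by blast
qed

lemma open_coord_image:
  assumes "c \<in> \<A>" "open O'" shows "open (coord c ` (dom_of c \<inter> O'))"
proof -
  have "openin (top_of_set (range_of c)) (coord c ` (dom_of c \<inter> O'))"
    by (rule homeomorphism_imp_open_map[OF chart_hom[OF assms(1)]]) (use assms(2) in auto)
  then show ?thesis using open_range[OF assms(1)] openin_open_eq by blast
qed

lemma open_param_image:
  assumes c: "c \<in> \<A>" and "open V" "V \<subseteq> range_of c" shows "open (param c ` V)"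
proof -
  have "openin (top_of_set (dom_of c)) (param c ` V)"
    by (rule homeomorphism_imp_open_map[OF homeomorphism_symD[OF chart_hom[OF c]]])
      (use assms in \<open>auto simp: openin_open\<close>)
  then show ?thesis using open_dom[OF c] openin_open_eq by blast
qed

lemma smooth_in_chart: "smooth_fun \<A> f \<Longrightarrow> c \<in> \<A> \<Longrightarrow> Ck_on k (f \<circ> param c) (range_of c)"
  using smooth_on_open_iff[OF open_range, of c "f \<circ> param c"] by (simp add: smooth_fun_def)

lemma smooth_transition:
  assumes "c \<in> \<A>" "d \<in> \<A>"
  shows "Ck_on k (coord d \<circ> param c) (coord c ` (dom_of c \<inter> dom_of d))"
proof -
  have "smooth_on (coord c ` (dom_of c \<inter> dom_of d)) (coord d \<circ> param c)"
    using atlas assms by (simp add: smooth_atlas_def compatible_def)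
  then show ?thesis using smooth_on_open_iff[OF open_coord_image[OF assms(1) open_dom[OF assms(2)]]] by blast
qed

text \<open>The differentials in two charts differ by the derivative of the transition map.\<close>

lemma critical_point_in_chart:
  assumes f: "smooth_fun \<A> f" and c: "c \<in> \<A>" "p \<in> dom_of c"
  shows "critical_point \<A> f p \<longleftrightarrow> differential c f p = (\<lambda>v. 0)"
proof
  assume "critical_point \<A> f p" then show "differential c f p = (\<lambda>v. 0)"
    using c by (auto simp: critical_point_def)
next
  assume 0: "differential c f p = (\<lambda>v. 0)"
  show "critical_point \<A> f p" unfolding critical_point_def
  proof (intro ballI impI)
    fix d assume d: "d \<in> \<A>" "p \<in> dom_of d"
    let ?O = "coord d ` (dom_of d \<inter> dom_of c)"
    let ?T = "coord c \<circ> param d"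
    have O: "open ?O" "coord d p \<in> ?O" using open_coord_image open_dom c d by auto
    have Tp: "?T (coord d p) = coord c p" using param_coord[OF d] by simp
    have "(?T has_derivative frechet_derivative ?T (at (coord d p))) (at (coord d p))"
      using Ck_on_has_derivative[OF smooth_transition[OF d(1) c(1)] O(2)] .
    moreover have "(f \<circ> param c has_derivative (\<lambda>v. 0)) (at (coord c p))"
      using Ck_on_has_derivative[OF smooth_in_chart[OF f c(1)], of "coord c p"] c(2) 0
      by (simp add: differential_def)
    ultimately have "((\<lambda>x. (f \<circ> param c) (?T x)) has_derivative (\<lambda>v. 0)) (at (coord d p))"
      using has_derivative_compose[of ?T _ "coord d p" UNIV "f \<circ> param c" "\<lambda>v. 0"] Tp by simp
    then have "(f \<circ> param d has_derivative (\<lambda>v. 0)) (at (coord d p))"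
      by (rule has_derivative_transform_within_open[OF _ O])
        (use param_coord[OF c(1)] param_coord[OF d(1)] in auto)
    then show "differential d f p = (\<lambda>v. 0)" unfolding differential_def
      by (rule frechet_derivative_at[symmetric])
  qed
qed

end

locale symplectic = atlas \<A>
  for \<A> :: "('m::{t2_space,second_countable_topology}, 'n::finite) chart set" +
  fixes \<omega> :: "('m, 'n) two_form"
  assumes symplectic: "symplectic_manifold \<A> \<omega>"
begin

lemma omega_bilinear: "c \<in> \<A> \<Longrightarrow> p \<in> dom_of c \<Longrightarrow> bilinear (\<omega> c p)"
  and omega_alternating: "c \<in> \<A> \<Longrightarrow> p \<in> dom_of c \<Longrightarrow> \<omega> c p v v = 0"
  using symplectic by (auto simp: symplectic_manifold_def is_two_form_def)

lemma omega_nondegenerate: "c \<in> \<A> \<Longrightarrow> p \<in> dom_of c \<Longrightarrow> (\<And>v. \<omega> c p u v = 0) \<Longrightarrow> u = 0"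
  using symplectic by (auto simp: symplectic_manifold_def)

lemma smooth_omega: "c \<in> \<A> \<Longrightarrow> Ck_on k (\<lambda>x. \<omega> c (param c x) u v) (range_of c)"
  using symplectic smooth_on_open_iff[OF open_range, of c "\<lambda>x. \<omega> c (param c x) u v"]
  by (simp add: symplectic_manifold_def is_two_form_def)

lemma ham_field_eq:
  assumes f: "smooth_fun \<A> f" and c: "c \<in> \<A>" "p \<in> dom_of c"
  shows "\<omega> c p (ham_field \<omega> c f p) v = - differential c f p v"
proof -
  let ?W = "\<lambda>u. gradient_of (\<omega> c p u)"
  have bil: "bilinear (\<omega> c p)" using omega_bilinear[OF c] .
  have W: "?W u \<bullet> v = \<omega> c p u v" for u v
    using inner_gradient_of bil by (auto simp: bilinear_def)
  have lin: "linear ?W" using linear_gradient_of_bilinear[OF bil] .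
  have "inj ?W" unfolding linear_injective_0[OF lin]
  proof (intro allI impI)
    fix u assume u: "?W u = 0"
    show "u = 0" by (rule omega_nondegenerate[OF c]) (use W[of u] u in simp)
  qed
  then have "surj ?W" by (rule linear_injective_imp_surjective[OF lin _ refl])
  from surjD[OF this, of "- gradient_of (differential c f p)"]
  obtain X where X: "- gradient_of (differential c f p) = ?W X" ..
  have "linear (differential c f p)" unfolding differential_def
    using Ck_on_has_derivative[OF smooth_in_chart[OF f c(1)], of "coord c p"] c(2)
      has_derivative_linear by blast
  then have XW: "\<omega> c p X v = - differential c f p v" for v
    unfolding W[symmetric] X[symmetric] by (simp add: inner_gradient_of)
  have uniq: "Y = X" if Y: "\<forall>v. \<omega> c p Y v = - differential c f p v" for Y
  proof -
    have "\<omega> c p (Y - X) v = 0" for v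
      unfolding bilinear_lsub[OF bil] using Y XW by simp
    then show "Y = X" using omega_nondegenerate[OF c, of "Y - X"] by simp
  qed
  have "\<forall>v. \<omega> c p (ham_field \<omega> c f p) v = - differential c f p v"
    unfolding ham_field_def by (rule theI[of _ X]) (use XW uniq in blast)+
  then show ?thesis by blast
qed

lemma ham_field_zero_iff:
  assumes "smooth_fun \<A> f" "c \<in> \<A>" "p \<in> dom_of c"
  shows "ham_field \<omega> c f p = 0 \<longleftrightarrow> differential c f p = (\<lambda>v. 0)"
proof
  assume "ham_field \<omega> c f p = 0"
  then show "differential c f p = (\<lambda>v. 0)"
    using ham_field_eq[OF assms] bilinear_lzero[OF omega_bilinear[OF assms(2,3)]] by auto
next
  assume "differential c f p = (\<lambda>v. 0)"
  then show "ham_field \<omega> c f p = 0"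
    using ham_field_eq[OF assms] by (intro omega_nondegenerate[OF assms(2,3)]) simp
qed

text \<open>In coordinates the Hamiltonian field is the solution of a linear system with smooth coefficients.\<close>

lemma smooth_ham_field:
  assumes f: "smooth_fun \<A> f" and c: "c \<in> \<A>"
  shows "Ck_on k (\<lambda>x. ham_field \<omega> c f (param c x)) (range_of c)"
proof -
  let ?U = "range_of c"
  let ?w = "\<lambda>x u. (\<chi> i. \<omega> c (param c x) u (axis i 1)) :: real ^ 'n"
  have U: "open ?U" using open_range[OF c] .
  have lin: "linear (?w x)" if "x \<in> ?U" for x
    using omega_bilinear[OF c param_in_dom[OF c that]]
    by (auto simp: linear_iff vec_eq_iff bilinear_ladd bilinear_lmul)
  show ?thesis
  proof (rule Ck_on_matrix_equation_solution[OF U, where A="\<lambda>x. matrix (?w x)"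
        and b="\<lambda>x. \<chi> i. - frechet_derivative (f \<circ> param c) (at x) (axis i 1)"])
    show "Ck_on k (\<lambda>x. matrix (?w x) $ i $ l) ?U" for i l
      using smooth_omega[OF c] by (simp add: matrix_def)
    have "Ck_on k (\<lambda>x. frechet_derivative (f \<circ> param c) (at x) v) ?U" for v
      using smooth_in_chart[OF f c, of "Suc k"] by simp
    then show "Ck_on k (\<lambda>x. (\<chi> i. - frechet_derivative (f \<circ> param c) (at x) (axis i 1)) $ i) ?U" for i
      using Ck_on_linear_compose[OF U bounded_linear_minus[OF bounded_linear_ident], where k=k,
          of "\<lambda>x. frechet_derivative (f \<circ> param c) (at x) (axis i 1)"] by simp
  next
    fix x assume x: "x \<in> ?U"
    note p = param_in_dom[OF c x]
    have "inj (?w x)" unfolding linear_injective_0[OF lin[OF x]]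
    proof (intro allI impI)
      fix u assume u: "?w x u = 0"
      show "u = 0"
      proof (rule omega_nondegenerate[OF c p])
        fix v
        have "linear (\<omega> c (param c x) u)" using omega_bilinear[OF c p] by (simp add: bilinear_def)
        moreover have "\<omega> c (param c x) u b = 0" if b: "b \<in> Basis" for b
        proof -
          obtain i where "b = axis i 1" using b by (auto simp: Basis_vec_def)
          then show ?thesis using arg_cong[OF u, of "\<lambda>y. y $ i"] by simp
        qed
        ultimately show "\<omega> c (param c x) u v = 0"
          using linear_eq_0_on_span[of "\<omega> c (param c x) u" Basis v] by simp
      qed
    qed
    then show "det (matrix (?w x)) \<noteq> 0" using det_nz_iff_inj[OF lin[OF x]] by blast
    have "matrix (?w x) *v ham_field \<omega> c f (param c x) = ?w x (ham_field \<omega> c f (param c x))"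
      by (rule matrix_works[OF lin[OF x, folded linear_matrix_vector_mul_eq]])
    then show "matrix (?w x) *v ham_field \<omega> c f (param c x)
        = (\<chi> i. - frechet_derivative (f \<circ> param c) (at x) (axis i 1))"
      using ham_field_eq[OF f c p] coord_param[OF c x] by (simp add: differential_def)
  qed
qed

text \<open>Since J and H commute, dJ(\<open>X_H\<close>) vanishes identically. In its derivative at p, the term that
contains the derivative of \<open>X_H\<close> is multiplied by dJ(p) = 0, and the other term is the Hessian.\<close>

lemma hessian_ham_field_zero:
  assumes J: "smooth_fun \<A> J" and H: "smooth_fun \<A> H" and comm: "poisson_commute \<A> \<omega> J H"
    and c: "c \<in> \<A>" "p \<in> dom_of c" and crit: "differential c J p = (\<lambda>v. 0)"
  shows "hessian c J p (ham_field \<omega> c H p) u = 0"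
proof -
  let ?U = "range_of c" and ?x0 = "coord c p" and ?j = "J \<circ> param c"
  let ?X = "\<lambda>x. ham_field \<omega> c H (param c x)"
  let ?d = "\<lambda>x. frechet_derivative ?j (at x)"
  interpret critical_jet ?U ?j ?x0
    by unfold_locales (use open_range c smooth_in_chart[OF J] crit in \<open>auto simp: differential_def\<close>)
  have zero: "(\<Sum>i\<in>UNIV. ?X x $ i * ?d x (axis i 1)) = 0" if x: "x \<in> ?U" for x
  proof -
    note p = param_in_dom[OF c(1) x]
    have "?d x (?X x) = - \<omega> c (param c x) (ham_field \<omega> c J (param c x)) (?X x)"
      using ham_field_eq[OF J c(1) p] coord_param[OF c(1) x] by (simp add: differential_def)
    also have "\<dots> = 0" using comm c(1) p by (simp add: poisson_commute_def)
    finally have "?d x (?X x) = 0" .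
    moreover have "?d x (\<Sum>i\<in>UNIV. (?X x $ i) *\<^sub>R axis i 1) = (\<Sum>i\<in>UNIV. ?X x $ i * ?d x (axis i 1))"
      by (simp only: linear_sum[OF linear_dj[OF x]] linear_scale[OF linear_dj[OF x]] real_scaleR_def)
    moreover have "(\<Sum>i\<in>UNIV. (?X x $ i) *\<^sub>R axis i 1) = ?X x"
      by (simp add: basis_expansion flip: scalar_mult_eq_scaleR)
    ultimately show ?thesis by simp
  qed
  have X': "((\<lambda>x. ?X x $ i) has_derivative (\<lambda>v. frechet_derivative ?X (at ?x0) v $ i)) (at ?x0)" for i
    by (rule bounded_linear.has_derivative[OF bounded_linear_vec_nth
          Ck_on_has_derivative[OF smooth_ham_field[OF H c(1)] x0]])
  have "((\<lambda>x. \<Sum>i\<in>UNIV. ?X x $ i * ?d x (axis i 1)) has_derivative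
      (\<lambda>v. \<Sum>i\<in>UNIV. ?X ?x0 $ i * Q (axis i 1) v + frechet_derivative ?X (at ?x0) v $ i * ?d ?x0 (axis i 1))) (at ?x0)"
    by (intro has_derivative_sum has_derivative_mult X' dj_has_derivative x0)
  then have "((\<lambda>x. 0) has_derivative
      (\<lambda>v. \<Sum>i\<in>UNIV. ?X ?x0 $ i * Q (axis i 1) v + frechet_derivative ?X (at ?x0) v $ i * ?d ?x0 (axis i 1))) (at ?x0)"
    by (rule has_derivative_transform_within_open[OF _ open_U x0]) (use zero in simp)
  from has_derivative_unique[OF this has_derivative_const]
  have "0 = (\<Sum>i\<in>UNIV. ?X ?x0 $ i * Q (axis i 1) u)"
    using crit by (simp add: fun_eq_iff differential_def)
  also have "\<dots> = Q (\<Sum>i\<in>UNIV. (?X ?x0 $ i) *\<^sub>R axis i 1) u"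
  proof -
    have l: "linear (\<lambda>a. Q a u)" using bilinear_Q by (simp add: bilinear_def)
    show ?thesis by (simp only: linear_sum[OF l] linear_scale[OF l] real_scaleR_def)
  qed
  also have "(\<Sum>i\<in>UNIV. (?X ?x0 $ i) *\<^sub>R axis i 1) = ?X ?x0"
    by (simp add: basis_expansion flip: scalar_mult_eq_scaleR)
  finally have "Q (?X ?x0) u = 0" by (rule sym)
  then show ?thesis unfolding hessian_def param_coord[OF c] .
qed

end

section \<open>The circle action in a chart\<close>

text \<open>The map \<open>\<psi>\<close> is the action in the coordinates of c, on the open set D of those (s, x) for which the
point x is carried into the domain of c by time s.\<close>

locale circle_in_chart = symplectic \<A> \<omega>
  for \<A> :: "('m::{t2_space,second_countable_topology}, 'n::finite) chart set" and \<omega> +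
  fixes \<Phi> :: "real \<Rightarrow> 'm \<Rightarrow> 'm" and J :: "'m \<Rightarrow> real" and c :: "('m, 'n) chart"
  assumes action: "smooth_circle_action \<A> \<Phi>" and momentum: "momentum_map_of \<A> \<omega> \<Phi> J"
    and c: "c \<in> \<A>"
begin

abbreviation "X \<equiv> \<lambda>x. ham_field \<omega> c J (param c x)"
abbreviation "\<psi> \<equiv> \<lambda>(s, x). coord c (\<Phi> s (param c x))"
abbreviation "D \<equiv> {(s, x). x \<in> range_of c \<and> \<Phi> s (param c x) \<in> dom_of c}"
abbreviation "\<psi>' \<equiv> \<lambda>z. frechet_derivative \<psi> (at z)"

lemma action_0: "\<Phi> 0 q = q" and action_2pi: "\<Phi> (2 * pi) q = q"
  and action_add: "\<Phi> (s + t) q = \<Phi> s (\<Phi> t q)"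
  using action by (simp_all add: smooth_circle_action_def)

lemma open_D: "open D"
proof -
  have cont: "continuous_on UNIV (\<lambda>(s, q). \<Phi> s q)" using action by (simp add: smooth_circle_action_def)
  have "continuous_on (UNIV \<times> range_of c) (\<lambda>z. (fst z, param c (snd z)))"
    by (intro continuous_intros continuous_on_compose2[OF cont_param[OF c]]) auto
  from continuous_on_compose2[OF cont this]
  have "continuous_on (UNIV \<times> range_of c) (\<lambda>z. \<Phi> (fst z) (param c (snd z)))" by simp
  from continuous_open_preimage[OF this _ open_dom[OF c]]
  have "open ((UNIV \<times> range_of c) \<inter> (\<lambda>z. \<Phi> (fst z) (param c (snd z))) -` dom_of c)"
    using open_range[OF c] by (simp add: open_Times)
  moreover have "(UNIV \<times> range_of c) \<inter> (\<lambda>z. \<Phi> (fst z) (param c (snd z))) -` dom_of c = D" by auto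
  ultimately show ?thesis by simp
qed

lemma smooth_\<psi>: "Ck_on k \<psi> D"
  using action c smooth_on_open_iff[OF open_D, of \<psi>] unfolding smooth_circle_action_def by blast

lemma \<psi>_deriv: "z \<in> D \<Longrightarrow> (\<psi> has_derivative \<psi>' z) (at z)"
  using Ck_on_has_derivative[OF smooth_\<psi>] .

lemma zero_in_D: "x \<in> range_of c \<Longrightarrow> (0, x) \<in> D"
  using param_in_dom[OF c] by (simp add: action_0)

lemma momentum_at: "q \<in> dom_of c \<Longrightarrow> ((\<lambda>s. coord c (\<Phi> s q)) has_vector_derivative ham_field \<omega> c J q) (at 0)"
  using momentum c by (simp add: momentum_map_of_def)

lemma orbit_velocity:
  assumes "(s, x) \<in> D"
  shows "((\<lambda>t. \<psi> (t, x)) has_vector_derivative X (\<psi> (s, x))) (at s)"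
proof -
  let ?q = "\<Phi> s (param c x)"
  have q: "?q \<in> dom_of c" using assms by simp
  have "((\<lambda>r. coord c (\<Phi> r ?q)) has_derivative (\<lambda>h. h *\<^sub>R ham_field \<omega> c J ?q)) (at (s - s))"
    using momentum_at[OF q] by (simp add: has_vector_derivative_def)
  moreover have "((\<lambda>t. t - s) has_derivative (\<lambda>h. h)) (at s)" by (auto intro!: derivative_eq_intros)
  ultimately have "((\<lambda>t. coord c (\<Phi> (t - s) ?q)) has_derivative (\<lambda>h. h *\<^sub>R ham_field \<omega> c J ?q)) (at s)"
    using has_derivative_compose[of "\<lambda>t. t - s" "\<lambda>h. h" s UNIV] by blast
  moreover have "\<Phi> (t - s) ?q = \<Phi> t (param c x)" for t using action_add[of "t - s" s] by simp
  ultimately show ?thesis using param_coord[OF c q] by (simp add: has_vector_derivative_def)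
qed

text \<open>The time s map commutes with the action, so its differential carries the generator of the action
to itself. This compares speeds along an orbit without solving a differential equation.\<close>

lemma field_pushforward:
  assumes D: "(s, x) \<in> D"
  shows "X (\<psi> (s, x)) = \<psi>' (s, x) (0, X x)"
proof -
  have x: "x \<in> range_of c" using D by simp
  let ?O = "(\<lambda>r. (r, x)) -` D"
  have "open ?O" by (rule open_vimage[OF open_D]) (intro continuous_intros)
  moreover have "0 \<in> ?O" using zero_in_D[OF x] by (rule vimageI2)
  ultimately have O: "open ?O" "0 \<in> ?O" by blast+
  have \<psi>0: "\<psi> (0, x) = x" using coord_param[OF c x] by (simp add: action_0)
  have "((\<lambda>r. \<psi> (r, x)) has_vector_derivative X x) (at 0)"
    using orbit_velocity[OF zero_in_D[OF x]] \<psi>0 by simp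
  then have "((\<lambda>r. (s, \<psi> (r, x))) has_derivative (\<lambda>h. (0, h *\<^sub>R X x))) (at 0)"
    unfolding has_vector_derivative_def by (intro has_derivative_Pair has_derivative_const)
  from has_derivative_compose[OF this, of \<psi> "\<psi>' (s, x)"]
  have "((\<lambda>r. \<psi> (s, \<psi> (r, x))) has_derivative (\<lambda>h. \<psi>' (s, x) (0, h *\<^sub>R X x))) (at 0)"
    using \<psi>_deriv[OF D] \<psi>0 by simp
  then have "((\<lambda>r. coord c (\<Phi> r (\<Phi> s (param c x)))) has_derivative (\<lambda>h. \<psi>' (s, x) (0, h *\<^sub>R X x))) (at 0)"
  proof (rule has_derivative_transform_within_open[OF _ O])
    fix r assume "r \<in> ?O"
    then have "param c (\<psi> (r, x)) = \<Phi> r (param c x)" using param_coord[OF c] by simp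
    then have "\<psi> (s, \<psi> (r, x)) = coord c (\<Phi> (s + r) (param c x))" by (simp add: action_add)
    also have "\<dots> = coord c (\<Phi> r (\<Phi> s (param c x)))" by (simp only: add.commute action_add)
    finally show "\<psi> (s, \<psi> (r, x)) = coord c (\<Phi> r (\<Phi> s (param c x)))" .
  qed
  moreover have "((\<lambda>r. coord c (\<Phi> r (\<Phi> s (param c x)))) has_derivative
      (\<lambda>h. h *\<^sub>R ham_field \<omega> c J (\<Phi> s (param c x)))) (at 0)"
    using momentum_at[of "\<Phi> s (param c x)"] D by (simp add: has_vector_derivative_def)
  ultimately have "(\<lambda>h. \<psi>' (s, x) (0, h *\<^sub>R X x)) = (\<lambda>h. h *\<^sub>R ham_field \<omega> c J (\<Phi> s (param c x)))"
    by (rule has_derivative_unique)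
  from fun_cong[OF this, of 1] show ?thesis using D param_coord[OF c] by simp
qed

text \<open>By the previous lemma the velocity of the orbit of p is zero as long as it stays in the chart, so p
is fixed for small times. The group law extends this to all times.\<close>

lemma rest_point_fixed:
  assumes p: "p \<in> dom_of c" and zero: "ham_field \<omega> c J p = 0" and s: "s \<ge> 0"
  shows "\<Phi> s p = p"
proof -
  let ?x = "coord c p"
  have x: "?x \<in> range_of c" "param c ?x = p" using p param_coord[OF c p] by auto
  let ?O = "(\<lambda>r. (r, ?x)) -` D"
  have "open ?O" by (rule open_vimage[OF open_D]) (intro continuous_intros)
  moreover have "0 \<in> ?O" using zero_in_D[OF x(1)] by (rule vimageI2)
  ultimately obtain e where e: "e > 0" "ball 0 e \<subseteq> ?O" using open_contains_ball by blast
  have small: "\<Phi> r p = p" if r: "0 \<le> r" "r < e" for r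
  proof -
    have D: "(t, ?x) \<in> D" if "t \<in> {0..r}" for t
    proof -
      have "t \<in> ball 0 e" using r that by simp
      then have "t \<in> ?O" using e(2) by blast
      then show ?thesis by (rule vimageD)
    qed
    have "norm (\<psi> (r, ?x) - \<psi> (0, ?x) - r *\<^sub>R 0) \<le> 0 * r"
    proof (rule drift_bound[where h="\<lambda>t. \<psi> (t, ?x)" and b=r])
      fix t assume t: "t \<in> {0..r}"
      show "((\<lambda>t. \<psi> (t, ?x)) has_vector_derivative X (\<psi> (t, ?x))) (at t)" using orbit_velocity[OF D[OF t]] .
      have "linear (\<psi>' (t, ?x))" using \<psi>_deriv[OF D[OF t]] has_derivative_linear by blast
      then have "\<psi>' (t, ?x) 0 = 0" by (rule linear_0)
      then have "\<psi>' (t, ?x) (0, 0) = 0" unfolding zero_prod_def .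
      then show "norm (X (\<psi> (t, ?x)) - 0) \<le> 0"
        unfolding field_pushforward[OF D[OF t]] x(2) zero by simp
    qed (use r in simp)
    then have coords: "coord c (\<Phi> r p) = coord c p" using x(2) by (simp add: action_0)
    have "\<Phi> r p \<in> dom_of c" using D[of r] r x(2) by auto
    then have "\<Phi> r p = param c (coord c (\<Phi> r p))" by (rule param_coord[OF c, symmetric])
    then show ?thesis unfolding coords x(2) .
  qed
  obtain n :: nat where n: "s / e < real n" using reals_Archimedean2 by blast
  then have n0: "real n > 0" using divide_nonneg_pos[OF s e(1)] by linarith
  define r where "r = s / real n"
  have "s < real n * e" using n e(1) by (simp add: pos_divide_less_eq)
  then have r: "0 \<le> r" "r < e" using n0 s by (simp_all add: r_def pos_divide_less_eq mult.commute)
  have "\<Phi> (real k * r) p = p" for k :: nat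
  proof (induction k)
    case (Suc k)
    have "real (Suc k) * r = real k * r + r" by (simp add: algebra_simps)
    then show ?case using Suc small[OF r] by (simp add: action_add)
  qed (simp add: action_0)
  from this[of n] show ?thesis using n0 by (simp add: r_def)
qed

text \<open>Since p is fixed, the compact set of all (s, p) with s in [0, 2 pi] lies in D. There the
differential of \<open>\<psi>\<close> in the space direction is bounded, and the tube lemma gives one
neighbourhood of p that serves all times.\<close>

lemma short_loops:
  assumes p: "p \<in> dom_of c" and zero: "ham_field \<omega> c J p = 0"
  shows "\<exists>C>0. \<forall>V. open V \<longrightarrow> coord c p \<in> V \<longrightarrow> (\<exists>d>0. \<forall>x\<in>ball (coord c p) d.
      \<exists>y::real\<Rightarrow>real^'n. y 0 = x \<and> y (2 * pi) = x \<and> (\<forall>s\<in>{0..2*pi}. y s \<in> V \<and>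
        (y has_vector_derivative X (y s)) (at s) \<and> norm (X (y s)) \<le> C * norm (X x)))"
proof -
  let ?x0 = "coord c p"
  let ?S = "{0..2*pi}"
  have x0: "?x0 \<in> range_of c" "param c ?x0 = p" using p param_coord[OF c p] by auto
  have rest: "\<Phi> s p = p" if "s \<in> ?S" for s using rest_point_fixed[OF p zero] that by simp
  \<comment> \<open>K bounds the operator norm of the partial derivative of the action in the space direction.\<close>
  define K where "K z = (\<Sum>b\<in>Basis. norm (\<psi>' z (0, b)))" for z
  have contK: "continuous_on D K" unfolding K_def
    using smooth_\<psi>[of "Suc 0"] by (intro continuous_intros) simp
  have K: "norm (\<psi>' z (0, v)) \<le> K z * norm v" if "z \<in> D" for z v
  proof -
    have "linear (\<lambda>v. (0, v))" by (simp add: linear_iff)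
    from linear_compose[OF this has_derivative_linear[OF \<psi>_deriv[OF that]]]
    have lin: "linear (\<lambda>v. \<psi>' z (0, v))" by (simp only: comp_def)
    have "\<psi>' z (0, v) = (\<Sum>b\<in>Basis. (v \<bullet> b) *\<^sub>R \<psi>' z (0, b))"
      by (subst (1) euclidean_representation[of v, symmetric])
        (simp only: linear_sum[OF lin] linear_scale[OF lin])
    also have "norm \<dots> \<le> (\<Sum>b\<in>Basis. norm v * norm (\<psi>' z (0, b)))"
      by (intro order_trans[OF norm_sum] sum_mono) (auto intro!: mult_right_mono Basis_le_norm)
    finally show ?thesis by (simp add: K_def sum_distrib_left[symmetric] mult.commute)
  qed
  have inD: "(s, ?x0) \<in> D" if "s \<in> ?S" for s using rest[OF that] p x0 by simp
  have "compact (?S \<times> {?x0})" by (intro compact_Times) auto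
  moreover have "continuous_on (?S \<times> {?x0}) K" by (rule continuous_on_subset[OF contK]) (use inD in blast)
  ultimately have "bounded (K ` (?S \<times> {?x0}))" by (intro compact_imp_bounded compact_continuous_image)
  then obtain C where "C > 0" and Cb: "\<forall>y \<in> K ` (?S \<times> {?x0}). norm y \<le> C" unfolding bounded_pos by blast
  show ?thesis
  proof (rule exI[of _ "C + 1"], intro conjI allI impI)
    show "C + 1 > 0" using \<open>C > 0\<close> by simp
    fix V assume V: "open V" "?x0 \<in> V"
    define O' where "O' = {z \<in> D. \<psi> z \<in> V \<and> K z < C + 1}"
    have "O' = (D \<inter> \<psi> -` V) \<inter> (D \<inter> K -` {..<C + 1})" by (auto simp: O'_def)
    moreover have "open (D \<inter> \<psi> -` V)"
      using continuous_open_preimage[OF Ck_on_imp_continuous_on[OF smooth_\<psi>] open_D V(1)] .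
    moreover have "open (D \<inter> K -` {..<C + 1})"
      by (rule continuous_open_preimage[OF contK open_D]) simp
    ultimately have openO: "open O'" by (simp only: open_Int)
    have subO: "(\<lambda>s. (s, ?x0)) ` ?S \<subseteq> O'"
    proof
      fix z assume "z \<in> (\<lambda>s. (s, ?x0)) ` ?S"
      then obtain s where s: "s \<in> ?S" "z = (s, ?x0)" by blast
      then have "K z \<in> K ` (?S \<times> {?x0})" by blast
      then have "norm (K z) \<le> C" using Cb by blast
      then have "K z \<le> C" by simp
      then show "z \<in> O'" using inD[OF s(1)] s(2) rest[OF s(1)] x0(2) V(2) by (simp add: O'_def)
    qed
    have ne: "?S \<noteq> {}" by (simp add: not_le)
    have opO: "openin (top_of_set (?S \<times> UNIV)) (O' \<inter> (?S \<times> UNIV))"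
      unfolding openin_open using openO by blast
    have sub: "(\<lambda>s. (s, ?x0)) ` ?S \<subseteq> O' \<inter> (?S \<times> UNIV)" using subO by auto
    obtain T where T: "openin (top_of_set UNIV) T" "?x0 \<in> T" "?S \<times> T \<subseteq> O' \<inter> (?S \<times> UNIV)"
      by (rule Retracts.tube_lemma[OF compact_Icc ne sub opO]) (rule that)
    have "open T" using T(1) by simp
    then obtain d where d: "d > 0" "ball ?x0 d \<subseteq> T" using T(2) open_contains_ball by blast
    show "\<exists>d>0. \<forall>x\<in>ball ?x0 d.
      \<exists>y::real\<Rightarrow>real^'n. y 0 = x \<and> y (2 * pi) = x \<and> (\<forall>s\<in>{0..2*pi}. y s \<in> V \<and>
        (y has_vector_derivative X (y s)) (at s) \<and> norm (X (y s)) \<le> (C + 1) * norm (X x))"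
    proof (rule exI[of _ d], intro conjI ballI d(1))
      fix x assume "x \<in> ball ?x0 d"
      then have O: "(s, x) \<in> O'" if "s \<in> ?S" for s using T(3) d(2) that by blast
      then have xr: "x \<in> range_of c" using O[of 0] by (simp add: O'_def)
      show "\<exists>y::real\<Rightarrow>real^'n. y 0 = x \<and> y (2 * pi) = x \<and> (\<forall>s\<in>{0..2*pi}. y s \<in> V \<and>
        (y has_vector_derivative X (y s)) (at s) \<and> norm (X (y s)) \<le> (C + 1) * norm (X x))"
      proof (intro exI[of _ "\<lambda>s. \<psi> (s, x)"] conjI ballI)
        show "\<psi> (0, x) = x" "\<psi> (2 * pi, x) = x"
          using coord_param[OF c xr] by (simp_all add: action_0 action_2pi)
        fix s assume s: "s \<in> ?S"
        have D: "(s, x) \<in> D" and Ks: "K (s, x) < C + 1" and "\<psi> (s, x) \<in> V"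
          using O[OF s] by (simp_all add: O'_def)
        show "\<psi> (s, x) \<in> V" by fact
        show "((\<lambda>s. \<psi> (s, x)) has_vector_derivative X (\<psi> (s, x))) (at s)"
          using orbit_velocity[OF D] .
        have "norm (X (\<psi> (s, x))) \<le> K (s, x) * norm (X x)"
          unfolding field_pushforward[OF D] by (rule K[OF D])
        also have "\<dots> \<le> (C + 1) * norm (X x)" using Ks by (intro mult_right_mono) auto
        finally show "norm (X (\<psi> (s, x))) \<le> (C + 1) * norm (X x)" .
      qed
    qed
  qed
qed

end

section \<open>Critical points of the momentum map\<close>

lemma homeomorphism_inv_into:
  assumes "homeomorphism S T f g"
  shows "homeomorphism S T f (inv_into S f)"
proof (rule homeomorphism_cong[OF assms refl refl refl])
  fix y assume y: "y \<in> T"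
  have "inj_on f S" using assms by (metis homeomorphism_apply1 inj_onI)
  moreover have "g y \<in> S" "f (g y) = y"
    using y homeomorphism_image2[OF assms] homeomorphism_apply2[OF assms] by blast+
  ultimately show "inv_into S f y = g y" by (metis inv_into_f_eq)
qed

lemma williamson_forms_independent:
  assumes "ty \<in> {Elliptic_Elliptic, Focus_Focus}"
    and 0: "\<And>z. a * fst (williamson_q ty) z + b * snd (williamson_q ty) z = 0"
  shows "a = 0 \<and> b = 0"
proof -
  define e :: "4 \<Rightarrow> real^4" where "e i = axis i 1" for i
  have e: "e 1 $ 1 = 1" "e 1 $ 2 = 0" "e 1 $ 3 = 0" "e 1 $ 4 = 0"
    "e 2 $ 1 = 0" "e 2 $ 2 = 1" "e 2 $ 3 = 0" "e 2 $ 4 = 0"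
    "e 3 $ 1 = 0" "e 3 $ 2 = 0" "e 3 $ 3 = 1" "e 3 $ 4 = 0"
    "e 4 $ 1 = 0" "e 4 $ 2 = 0" "e 4 $ 3 = 0" "e 4 $ 4 = 1"
    by (simp_all add: e_def axis_def)
  from assms(1) consider "ty = Elliptic_Elliptic" | "ty = Focus_Focus" by blast
  then show ?thesis
  proof cases
    case 1
    then show ?thesis using 0[of "e 1"] 0[of "e 3"] by (simp add: e)
  next
    case 2
    then show ?thesis using 0[of "e 1 + e 4"] 0[of "e 1 + e 2"] by (simp add: e)
  qed
qed

text \<open>At rank zero, a vanishing Hessian of J contradicts the independence of the two Williamson model
forms. At rank one, non-degeneracy would force the symplectic complement of the
line L spanned by the Hamiltonian field of H into L; but the complement contains a
symplectic pair, and a line does not.\<close>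

lemma hessian_nonzero_at_critical_point:
  assumes st: "semitoric_system \<A> \<omega> J H" and crit: "critical_point \<A> J p"
    and c: "c \<in> \<A>" "p \<in> dom_of c"
  obtains u v where "hessian c J p u v \<noteq> 0"
proof -
  have int: "integrable_system \<A> \<omega> J H" using st by (simp add: semitoric_system_def)
  interpret symplectic \<A> \<omega>
    by unfold_locales (use int in \<open>auto simp: integrable_system_def symplectic_manifold_def\<close>)
  have J: "smooth_fun \<A> J" using int by (simp add: integrable_system_def)
  have XJ: "ham_field \<omega> c' J p = 0" if "c' \<in> \<A>" "p \<in> dom_of c'" for c'
    using ham_field_zero_iff[OF J that] critical_point_in_chart[OF J that] crit by blast
  have "singular_point \<A> \<omega> J H p"
    unfolding singular_point_def lin_dependent_def
    using XJ by (intro ballI impI exI[of _ 1] exI[of _ 0]) simp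
  then have nd: "nondegenerate_nonhyperbolic \<A> \<omega> J H p"
    using st by (simp add: semitoric_system_def)
  have "\<not> (\<forall>u v. hessian c J p u v = 0)"
  proof
    assume Q0: "\<forall>u v. hessian c J p u v = 0"
    show False
    proof (cases "fixed_point \<A> J H p")
      case True
      then have "nondegenerate_nonhyperbolic_rank0 \<omega> c J H p"
        using nd c unfolding nondegenerate_nonhyperbolic_def by auto
      then obtain ty where ty: "ty \<in> {Elliptic_Elliptic, Focus_Focus}"
        "has_williamson_type (\<omega> c p) (hessian c J p) (hessian c H p) ty"
        unfolding nondegenerate_nonhyperbolic_rank0_def by blast
      then obtain B :: "real^4^4" and a b k l where kl: "a * l - b * k \<noteq> 0"
        and q: "\<forall>z. hessian c J p (B *v z) (B *v z)
            = a * fst (williamson_q ty) z + b * snd (williamson_q ty) z \<and>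
          hessian c H p (B *v z) (B *v z)
            = k * fst (williamson_q ty) z + l * snd (williamson_q ty) z"
        unfolding has_williamson_type_def by (elim exE conjE) (rule that)
      have "a * fst (williamson_q ty) z + b * snd (williamson_q ty) z = 0" for z
        using spec[OF q, of z] Q0 by simp
      then have "a = 0 \<and> b = 0" by (rule williamson_forms_independent[OF ty(1)])
      then show False using kl by simp
    next
      case False
      then have r1: "nondegenerate_nonhyperbolic_rank1 \<omega> c J H p"
        using nd c unfolding nondegenerate_nonhyperbolic_def by auto
      let ?X = "ham_field \<omega> c H p"
      let ?L = "span {ham_field \<omega> c J p, ?X}"
      let ?L' = "symplectic_orthogonal (\<omega> c p) ?L"
      have Q: "hessian c (\<lambda>q. 1 * J q + 0 * H q) p u v = 0" for u v using Q0 by simp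
      \<comment> \<open>Since dJ(p) = 0, the combination 1 J + 0 H is the one that is critical at p.\<close>
      have "(1::real, 0::real) \<noteq> (0, 0) \<and> 1 *\<^sub>R ham_field \<omega> c J p + 0 *\<^sub>R ?X = 0"
        using XJ[OF c] by simp
      note R = mp[OF spec[OF spec[OF r1[unfolded nondegenerate_nonhyperbolic_rank1_def Let_def], of 1], of 0] this]
      have "\<forall>u\<in>?L'. u \<in> ?L" using conjunct1[OF R] Q by blast
      moreover have "\<exists>e\<in>?L'. \<exists>f\<in>?L'. \<omega> c p e f = 1" using conjunct2[OF R] by blast
      ultimately obtain e f where ef: "e \<in> ?L" "f \<in> ?L" "\<omega> c p e f = 1" by blast
      have "?L = range (\<lambda>k. k *\<^sub>R ?X)" using XJ[OF c] by (simp add: span_singleton)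
      then obtain a b where "e = a *\<^sub>R ?X" "f = b *\<^sub>R ?X" using ef(1,2) by auto
      then have "\<omega> c p e f = 0"
        using omega_bilinear[OF c] omega_alternating[OF c] by (simp add: bilinear_lmul bilinear_rmul)
      then show False using ef(3) by simp
    qed
  qed
  then show thesis using that by blast
qed

context symplectic
begin

lemma critical_jet_in_chart:
  assumes J: "smooth_fun \<A> J" and crit: "critical_point \<A> J p" and c: "c \<in> \<A>" "p \<in> dom_of c"
  shows "critical_jet (range_of c) (J \<circ> param c) (coord c p)"
proof
  show "open (range_of c)" using open_range[OF c(1)] .
  show "coord c p \<in> range_of c" using c(2) by simp
  show "Ck_on k (J \<circ> param c) (range_of c)" for k using smooth_in_chart[OF J c(1)] .
  show "frechet_derivative (J \<circ> param c) (at (coord c p)) = (\<lambda>v. 0)"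
    using critical_point_in_chart[OF J c] crit by (simp add: differential_def)
qed

lemma critical_param_iff:
  assumes J: "smooth_fun \<A> J" and c: "c \<in> \<A>" and x: "x \<in> range_of c"
  shows "critical_point \<A> J (param c x) \<longleftrightarrow> frechet_derivative (J \<circ> param c) (at x) = (\<lambda>v. 0)"
  using critical_point_in_chart[OF J c param_in_dom[OF c x]] coord_param[OF c x]
  by (simp add: differential_def)

lemma nondegenerate_imp_isolated:
  assumes J: "smooth_fun \<A> J" and critp: "critical_point \<A> J p" and c: "c \<in> \<A>" "p \<in> dom_of c"
    and nondeg: "\<And>u. (\<And>v. hessian c J p u v = 0) \<Longrightarrow> u = 0"
  shows "\<exists>O'. open O' \<and> {q. critical_point \<A> J q} \<inter> O' = {p}"
proof -
  interpret critical_jet "range_of c" "J \<circ> param c" "coord c p"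
    by (rule critical_jet_in_chart[OF J critp c])
  have "N = {0}"
  proof
    show "N \<subseteq> {0}" using nondeg by (auto simp: hessian_def)
    show "{0} \<subseteq> N" using subspace_0[OF subspace_N] by simp
  qed
  from nondegenerate_critical_point_isolated[OF this]
  obtain r where r: "r > 0" "ball (coord c p) r \<subseteq> range_of c"
    "\<forall>x\<in>ball (coord c p) r. dj x = (\<lambda>v. 0) \<longrightarrow> x = coord c p"
    by (elim exE conjE) (rule that)
  have "open (param c ` ball (coord c p) r)" by (rule open_param_image[OF c(1) open_ball r(2)])
  moreover have "{q. critical_point \<A> J q} \<inter> param c ` ball (coord c p) r = {p}"
  proof
    show "{p} \<subseteq> {q. critical_point \<A> J q} \<inter> param c ` ball (coord c p) r"
      using critp r(1) param_coord[OF c] by (auto intro!: image_eqI[of p "param c" "coord c p"])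
    show "{q. critical_point \<A> J q} \<inter> param c ` ball (coord c p) r \<subseteq> {p}"
    proof
      fix q assume "q \<in> {q. critical_point \<A> J q} \<inter> param c ` ball (coord c p) r"
      then obtain x where x: "x \<in> ball (coord c p) r" "q = param c x" "critical_point \<A> J (param c x)" by blast
      then have "dj x = (\<lambda>v. 0)" using critical_param_iff[OF J c(1)] r(2) by blast
      then have "x = coord c p" using r(3) x(1) by blast
      then show "q \<in> {p}" using x(2) param_coord[OF c] by simp
    qed
  qed
  ultimately show ?thesis by blast
qed

lemma commuting_function_critical:
  assumes J: "smooth_fun \<A> J" and H: "smooth_fun \<A> H" and comm: "poisson_commute \<A> \<omega> J H"
    and crit: "critical_point \<A> J p" and c: "c \<in> \<A>" "p \<in> dom_of c"
    and nondeg: "\<And>u. (\<And>v. hessian c J p u v = 0) \<Longrightarrow> u = 0"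
  shows "critical_point \<A> H p"
proof -
  have "differential c J p = (\<lambda>v. 0)" using critical_point_in_chart[OF J c] crit by blast
  then have "ham_field \<omega> c H p = 0"
    by (intro nondeg hessian_ham_field_zero[OF J H comm c])
  then show ?thesis using ham_field_zero_iff[OF H c] critical_point_in_chart[OF H c] by blast
qed

end

lemma (in atlas) subchart:
  fixes F G :: "real^'n \<Rightarrow> real^'n"
  assumes c: "c \<in> \<A>" and V: "open V" "V \<subseteq> range_of c" and R: "open R"
    and hom: "homeomorphism V R F G" and F: "\<And>k. Ck_on k F V" and G: "\<And>k. Ck_on k G R"
  defines "d \<equiv> (param c ` V, F \<circ> coord c)"
  shows "is_chart d" "\<And>c'. c' \<in> \<A> \<Longrightarrow> compatible c' d" "range_of d = R"
    and "\<And>y. y \<in> R \<Longrightarrow> param d y = param c (G y)"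
proof -
  have FV: "F ` V = R" and GR: "G ` R = V" and FG: "\<And>y. y \<in> R \<Longrightarrow> F (G y) = y"
    using hom by (auto simp: homeomorphism_def)
  have cV: "coord c ` param c ` V = V"
  proof -
    have "(\<lambda>x. coord c (param c x)) ` V = (\<lambda>x. x) ` V"
      by (rule image_cong[OF refl coord_param[OF c subsetD[OF V(2)]]])
    then show ?thesis by (simp add: image_image)
  qed
  have homc: "homeomorphism (param c ` V) V (coord c) (param c)"
    by (rule homeomorphism_symD[OF homeomorphism_of_subsets[OF
            homeomorphism_symD[OF chart_hom[OF c]] V(2) empty_subsetI refl]])
  have homd: "homeomorphism (dom_of d) R (coord d) (param c \<circ> G)"
    using homeomorphism_compose[OF homc hom] by (simp add: d_def)
  then show range: "range_of d = R" by (rule homeomorphism_image1)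
  have odom: "open (dom_of d)" using open_param_image[OF c V] by (simp add: d_def)
  have homd': "homeomorphism (dom_of d) (range_of d) (coord d) (param d)"
    unfolding range using homeomorphism_inv_into[OF homd] by (simp add: param_def)
  then show "is_chart d" unfolding is_chart_def using odom R range by simp
  show pd: "param d y = param c (G y)" if y: "y \<in> R" for y
  proof -
    have "param c (G y) \<in> dom_of d" using GR y by (auto simp: d_def)
    then have "param d (coord d (param c (G y))) = param c (G y)" by (rule homeomorphism_apply1[OF homd'])
    then show ?thesis using homeomorphism_apply2[OF homd y] by simp
  qed
  show "compatible c' d" if c': "c' \<in> \<A>" for c'
  proof -
    let ?A = "coord c' ` (dom_of c' \<inter> dom_of d)" and ?B = "coord d ` (dom_of c' \<inter> dom_of d)"
    have dc: "dom_of d \<subseteq> dom_of c" using V(2) param_in_dom[OF c] by (auto simp: d_def)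
    have oA: "open ?A" by (rule open_coord_image[OF c' odom])
    have "openin (top_of_set R) ?B"
      by (rule homeomorphism_imp_open_map[OF homd]) (use open_dom[OF c'] in \<open>auto simp: openin_open\<close>)
    then have oB: "open ?B" using R openin_open_eq by blast
    have "Ck_on k (\<lambda>x. F ((coord c \<circ> param c') x)) ?A" for k
    proof (rule Ck_on_compose[OF oA V(1) _ _ F])
      show "Ck_on k (coord c \<circ> param c') ?A"
        by (rule Ck_on_subset[OF smooth_transition[OF c' c]]) (use dc in blast)
      show "(coord c \<circ> param c') ` ?A \<subseteq> V"
        using cV param_coord[OF c'] by (auto simp: d_def)
    qed
    then have 1: "smooth_on ?A (coord d \<circ> param c')"
      unfolding smooth_on_open_iff[OF oA] by (simp add: d_def comp_def)
    have "Ck_on k (coord c' \<circ> param d) ?B" for k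
    proof (rule Ck_on_cong[OF oB])
      have BR: "?B \<subseteq> R" using range by blast
      let ?O = "coord c ` (dom_of c \<inter> dom_of c')"
      have im: "G ` ?B \<subseteq> ?O"
      proof
        fix z assume "z \<in> G ` ?B"
        then obtain q where q: "q \<in> dom_of c'" "q \<in> dom_of d" "z = G (coord d q)" by blast
        have "q = param c z" using homeomorphism_apply1[OF homd q(2)] q(3) by simp
        moreover have "z \<in> range_of c" using q(2,3) range GR V(2) by blast
        ultimately have "z = coord c q" using coord_param[OF c] by simp
        then show "z \<in> ?O" using q dc by blast
      qed
      show "Ck_on k (\<lambda>y. (coord c' \<circ> param c) (G y)) ?B"
        by (rule Ck_on_compose[OF oB open_coord_image[OF c open_dom[OF c']] im
              Ck_on_subset[OF G BR] smooth_transition[OF c c']])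
      show "(coord c' \<circ> param c) (G y) = (coord c' \<circ> param d) y" if "y \<in> ?B" for y
        using pd BR that by auto
    qed
    then have 2: "smooth_on ?B (coord c' \<circ> param d)" unfolding smooth_on_open_iff[OF oB] by blast
    show "compatible c' d" unfolding compatible_def using 1 2 by simp
  qed
qed

section \<open>Fixed points of semitoric families\<close>

text \<open>The two cases are those of a kernel of dimension 0 and 2. In the second case, the chart image of the
critical set is a disc, because the range of the slice chart is a ball; connectedness
places this disc in a single component of the critical set.\<close>

lemma isolated_or_slice:
  fixes \<A> :: "('m::{t2_space,second_countable_topology}, 4) chart set"
  assumes st: "semitoric_system \<A> \<omega> J H" and critq: "critical_point \<A> J q"
  defines "K \<equiv> {p. critical_point \<A> J p}"
  shows "(\<exists>c\<in>\<A>. q \<in> dom_of c \<and> (\<forall>u. (\<forall>v. hessian c J q u v = 0) \<longrightarrow> u = 0)) \<or>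
    (\<exists>d. is_chart d \<and> (\<forall>c\<in>\<A>. compatible c d) \<and> q \<in> dom_of d \<and> connected (K \<inter> dom_of d) \<and>
       coord d ` (K \<inter> dom_of d) = {x \<in> range_of d. x $ 3 = 0 \<and> x $ 4 = 0})"
proof -
  have int: "integrable_system \<A> \<omega> J H" using st by (simp add: semitoric_system_def)
  interpret symplectic \<A> \<omega>
    by unfold_locales (use int in \<open>auto simp: integrable_system_def symplectic_manifold_def\<close>)
  have J: "smooth_fun \<A> J" using int by (simp add: integrable_system_def)
  obtain c where cq: "c \<in> \<A>" "q \<in> dom_of c" using chart_around[of q] by blast
  obtain \<Phi> where \<Phi>: "smooth_circle_action \<A> \<Phi>" "momentum_map_of \<A> \<omega> \<Phi> J"
    using st unfolding semitoric_system_def by blast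
  interpret circle_in_chart \<A> \<omega> \<Phi> J c by unfold_locales (fact \<Phi> cq(1))+
  let ?U = "range_of c" and ?j = "J \<circ> param c" and ?x0 = "coord c q"
  let ?w = "\<lambda>x. \<omega> c (param c x)"
  have x0: "param c ?x0 = q" using param_coord[OF cq] .
  have zero: "ham_field \<omega> c J q = 0"
    using ham_field_zero_iff[OF J cq] critical_point_in_chart[OF J cq] critq by blast
  have flow: "periodic_flow ?U ?j ?x0 ?w X"
  proof (intro periodic_flow.intro critical_jet_in_chart[OF J critq cq] periodic_flow_axioms.intro)
    show "bilinear (?w x)" if "x \<in> ?U" for x using omega_bilinear[OF cq(1) param_in_dom[OF cq(1) that]] .
    show "?w ?x0 v v = 0" for v unfolding x0 using omega_alternating[OF cq] .
    show "u = 0" if "\<And>v. ?w ?x0 u v = 0" for u using omega_nondegenerate[OF cq] that unfolding x0 by blast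
    show "continuous_on ?U (\<lambda>x. ?w x u v)" for u v
      by (rule Ck_on_imp_continuous_on[OF smooth_omega[OF cq(1)]])
    show "?w x (X x) v = - frechet_derivative ?j (at x) v" if "x \<in> ?U" for x v
      using ham_field_eq[OF J cq(1) param_in_dom[OF cq(1) that]] coord_param[OF cq(1) that]
      by (simp add: differential_def)
    show "\<exists>C>0. \<forall>V. open V \<longrightarrow> ?x0 \<in> V \<longrightarrow> (\<exists>d>0. \<forall>x\<in>ball ?x0 d.
      \<exists>y::real\<Rightarrow>real^4. y 0 = x \<and> y (2 * pi) = x \<and> (\<forall>s\<in>{0..2*pi}. y s \<in> V \<and>
        (y has_vector_derivative X (y s)) (at s) \<and> norm (X (y s)) \<le> C * norm (X x)))"
      by (rule short_loops[OF cq(2) zero])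
  qed
  then interpret F: periodic_flow ?U ?j ?x0 ?w X .
  let ?N = "{u. \<forall>v. frechet_derivative (\<lambda>x. frechet_derivative ?j (at x) u) (at ?x0) v = 0}"
  have N: "?N = {u. \<forall>v. hessian c J q u v = 0}" by (simp add: hessian_def)
  define n where "n = dim ?N"
  have "n \<in> {0, 2, 4}" unfolding n_def by (rule F.dim_kernel) simp
  moreover have "n \<noteq> 4"
  proof
    assume "n = 4"
    then have "dim ?N = DIM(real^4)" by (simp add: n_def)
    then have "span ?N = UNIV" by (simp only: dim_eq_full)
    then have "?N = UNIV" unfolding F.span_N .
    then have "hessian c J q u v = 0" for u v unfolding N by blast
    then show False using hessian_nonzero_at_critical_point[OF st critq cq] by blast
  qed
  ultimately consider "n = 0" | "n = 2" by blast
  then show ?thesis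
  proof cases
    case 1
    then have "?N \<subseteq> {0}" unfolding n_def dim_eq_0 .
    then have "\<forall>u. (\<forall>v. hessian c J q u v = 0) \<longrightarrow> u = 0" unfolding N by blast
    then show ?thesis using cq by blast
  next
    case 2
    show ?thesis
    proof (rule critical_set_slice[OF flow 2[unfolded n_def]])
      fix V r G and F :: "real^4 \<Rightarrow> real^4"
      assume V: "open V" "?x0 \<in> V" "V \<subseteq> ?U" and r: "r > 0"
        and hom: "homeomorphism V (ball (F ?x0) r) F G"
        and sF: "\<And>k. Ck_on k F V" and sG: "\<And>k. Ck_on k G (ball (F ?x0) r)"
        and slice: "\<And>x. x \<in> V \<Longrightarrow> frechet_derivative ?j (at x) = (\<lambda>v. 0) \<longleftrightarrow> F x $ 3 = 0 \<and> F x $ 4 = 0"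
      define d where "d = (param c ` V, F \<circ> coord c)"
      let ?B = "ball (F ?x0) r"
      let ?E = "{y \<in> ?B. y $ 3 = 0 \<and> y $ 4 = 0}"
      note d = subchart[OF cq(1) V(1,3) open_ball hom sF sG, folded d_def]
      have cp: "coord c (param c x) = x" if "x \<in> V" for x
        using coord_param[OF cq(1)] V(3) that by blast
      let ?Z = "{x \<in> V. F x $ 3 = 0 \<and> F x $ 4 = 0}"
      have crit_iff: "param c x \<in> K \<longleftrightarrow> F x $ 3 = 0 \<and> F x $ 4 = 0" if x: "x \<in> V" for x
      proof -
        have "x \<in> ?U" using V(3) x by blast
        from critical_param_iff[OF J cq(1) this] show ?thesis
          unfolding K_def mem_Collect_eq slice[OF x] .
      qed
      have "K \<inter> param c ` V = param c ` {x \<in> V. param c x \<in> K}" by blast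
      also have "{x \<in> V. param c x \<in> K} = ?Z" by (rule Collect_cong, rule conj_cong[OF refl crit_iff])
      finally have Kd: "K \<inter> dom_of d = param c ` ?Z" unfolding d_def fst_conv .
      have "{y \<in> F ` V. y $ 3 = 0 \<and> y $ 4 = 0} = F ` ?Z" by blast
      then have E: "?E = F ` ?Z" unfolding homeomorphism_image1[OF hom] .
      have "coord d ` (K \<inter> dom_of d) = F ` ?Z"
        unfolding Kd image_image by (rule image_cong[OF refl]) (use cp in \<open>simp add: d_def\<close>)
      then have 1: "coord d ` (K \<inter> dom_of d) = {x \<in> range_of d. x $ 3 = 0 \<and> x $ 4 = 0}"
        unfolding d(3) E .
      have "(\<lambda>x. G (F x)) ` ?Z = (\<lambda>x. x) ` ?Z"
        by (rule image_cong[OF refl]) (use homeomorphism_apply1[OF hom] in blast)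
      then have "?Z = G ` ?E" unfolding E by (simp only: image_image image_ident)
      then have Kd': "K \<inter> dom_of d = (\<lambda>y. param c (G y)) ` ?E" unfolding Kd by (simp only: image_image)
      have "convex {y :: real^4. y $ 3 = 0 \<and> y $ 4 = 0}" by (auto simp: convex_def)
      then have "convex (?B \<inter> {y. y $ 3 = 0 \<and> y $ 4 = 0})" by (intro convex_Int convex_ball)
      then have "connected ?E" by (simp add: convex_connected Int_def)
      moreover have "continuous_on ?E (\<lambda>y. param c (G y))"
      proof (rule continuous_on_compose2[OF cont_param[OF cq(1)]])
        show "continuous_on ?E G"
          by (rule continuous_on_subset[OF homeomorphism_cont2[OF hom]]) blast
        show "G ` ?E \<subseteq> range_of c" using homeomorphism_image2[OF hom] V(3) by blast
      qed
      ultimately have 2: "connected (K \<inter> dom_of d)" unfolding Kd' by (intro connected_continuous_image)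
      have "q \<in> dom_of d" unfolding d_def using V(2) x0 by force
      then show ?thesis using d(1,2) 1 2 by blast
    qed
  qed
qed

theorem lemma3p4:
  fixes \<A> :: "('m::{t2_space,second_countable_topology}, 4) chart set"
    and \<omega> :: "('m, 4) two_form"
    and J :: "'m \<Rightarrow> real" and H :: "real \<Rightarrow> 'm \<Rightarrow> real"
    and T :: "real set" and t0 :: real and p :: 'm
  assumes "semitoric_family \<A> \<omega> J H T"
    and "t0 \<in> {0..1}"
    and "fixed_point \<A> J (H t0) p"
    and "\<not> (\<exists>S. fixed_surface \<A> J S \<and> p \<in> S)"
  shows "\<forall>t\<in>{0..1}. fixed_point \<A> J (H t) p"
proof -
  have "finite T" and int: "\<And>t. t \<in> {0..1} \<Longrightarrow> integrable_system \<A> \<omega> J (H t)"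
    and st: "\<And>t. t \<in> {0..1} \<Longrightarrow> t \<notin> T \<Longrightarrow> semitoric_system \<A> \<omega> J (H t)"
    using assms(1) by (auto simp: semitoric_family_def)
  have "infinite {0..1::real}" by (simp add: infinite_Icc)
  then obtain t1 where "t1 \<in> {0..1}" "t1 \<notin> T" using \<open>finite T\<close> by (meson finite_subset subsetI)
  then have st1: "semitoric_system \<A> \<omega> J (H t1)" using st by blast
  have int0: "integrable_system \<A> \<omega> J (H t0)" using int assms(2) .
  interpret symplectic \<A> \<omega>
    by unfold_locales (use int0 in \<open>auto simp: integrable_system_def symplectic_manifold_def\<close>)
  have J: "smooth_fun \<A> J" using int0 by (simp add: integrable_system_def)
  define K where "K = {q. critical_point \<A> J q}"
  define nondeg where "nondeg q \<longleftrightarrow>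
    (\<exists>c\<in>\<A>. q \<in> dom_of c \<and> (\<forall>u. (\<forall>v. hessian c J q u v = 0) \<longrightarrow> u = 0))" for q
  have critp: "critical_point \<A> J p" using assms(3) by (simp add: fixed_point_def)
  have dichotomy: "nondeg q \<or> (\<exists>d. is_chart d \<and> (\<forall>c\<in>\<A>. compatible c d) \<and> q \<in> dom_of d \<and>
      connected (K \<inter> dom_of d) \<and> coord d ` (K \<inter> dom_of d) = {x \<in> range_of d. x $ 3 = 0 \<and> x $ 4 = 0})"
    if "q \<in> K" for q
    using isolated_or_slice[OF st1, of q] that unfolding K_def nondeg_def by blast
  have "nondeg p"
  proof (rule ccontr)
    assume np: "\<not> nondeg p"
    define S where "S = connected_component_set K p"
    have "p \<in> K" using critp by (simp add: K_def)
    then have S: "S \<in> components K" and pS: "p \<in> S"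
      by (auto simp: S_def components_def connected_component_refl_eq)
    have "connected S" "S \<subseteq> K"
      using S in_components_connected in_components_subset by blast+
    have no_nondeg: "\<not> nondeg q" if q: "q \<in> S" for q
    proof
      assume nq: "nondeg q"
      then obtain c where c: "c \<in> \<A>" "q \<in> dom_of c" "\<And>u. (\<And>v. hessian c J q u v = 0) \<Longrightarrow> u = 0"
        unfolding nondeg_def by blast
      have "critical_point \<A> J q" using q \<open>S \<subseteq> K\<close> by (auto simp: K_def)
      from nondegenerate_imp_isolated[OF J this c] obtain O' where O': "open O'" "K \<inter> O' = {q}"
        unfolding K_def by blast
      \<comment> \<open>An isolated point of the connected set S is open and closed in it, so it is all of S.\<close>
      have "openin (top_of_set S) {q}"
        unfolding openin_open using O' q \<open>S \<subseteq> K\<close> by blast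
      moreover have "closedin (top_of_set S) {q}"
        unfolding closedin_closed using q closed_singleton[of q] by blast
      ultimately have "S = {q}" using \<open>connected S\<close> unfolding connected_clopen by blast
      then show False using pS np nq by blast
    qed
    have "fixed_surface \<A> J S" unfolding fixed_surface_def
    proof (intro conjI ballI)
      show "S \<in> components {p. critical_point \<A> J p}" using S by (simp add: K_def)
      fix q assume q: "q \<in> S"
      then obtain d where d: "is_chart d" "\<forall>c\<in>\<A>. compatible c d" "q \<in> dom_of d" "connected (K \<inter> dom_of d)"
        "coord d ` (K \<inter> dom_of d) = {x \<in> range_of d. x $ 3 = 0 \<and> x $ 4 = 0}"
        using dichotomy[of q] no_nondeg \<open>S \<subseteq> K\<close> by blast
      have "K \<inter> dom_of d \<subseteq> S"
        by (rule components_maximal[OF S d(4)]) (use q d(3) \<open>S \<subseteq> K\<close> in auto)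
      then have eq: "S \<inter> dom_of d = K \<inter> dom_of d" using \<open>S \<subseteq> K\<close> by blast
      show "\<exists>d. is_chart d \<and> (\<forall>c\<in>\<A>. compatible c d) \<and> q \<in> dom_of d \<and>
          coord d ` (S \<inter> dom_of d) = {x \<in> range_of d. x $ 3 = 0 \<and> x $ 4 = 0}"
        by (intro exI[of _ d] conjI d(1-3)) (unfold eq, rule d(5))
    qed
    then show False using assms(4) pS by blast
  qed
  then obtain c where c: "c \<in> \<A>" "p \<in> dom_of c" "\<And>u. (\<And>v. hessian c J p u v = 0) \<Longrightarrow> u = 0"
    unfolding nondeg_def by blast
  show ?thesis
  proof
    fix t :: real assume "t \<in> {0..1}"
    from int[OF this] have "smooth_fun \<A> (H t)" "poisson_commute \<A> \<omega> J (H t)"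
      by (simp_all add: integrable_system_def)
    then have "critical_point \<A> (H t) p" by (rule commuting_function_critical[OF J _ _ critp c])
    then show "fixed_point \<A> J (H t) p" using critp by (simp add: fixed_point_def)
  qed
qed

end
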